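(* Let $X$ be a symmetric random variable such that $\mathbb E X=0=\mathbb E X^3$, $\mathbb E X^2=1$ and $\mathbb E|X|^{3+\varepsilon}<\infty$ for some $\varepsilon>0$. Let $X_i$, $i\ge1$, be independent copies of $X$ and $S_n=X_1+\dots+X_n$. Let $k$ be a positive integer and $\ell$ an odd integer (both allowed to depend on $n$) such that $(\ell,k)=1$ and $\sqrt{n\log\log n}/k\to\infty$ as $n\to\infty$. Then for every $B>1$, as $n\to\infty$, $$\mathbb P\big\{S_n\text{ is prime},\ S_n\equiv\ell\ (\mathrm{mod}\ k)\big\}=\mathcal O_B\Big\{\frac{\sqrt{\log\log n}}{\varphi(k)\log n}+\frac{1}{(\log n)^B}\Big\}.$$
   Context: $\varphi$ is Euler's totient function and $(\ell,k)$ the greatest common divisor. An integer $r$ (possibly negative) is counted as prime if $|r|$ is a prime number. The law of $X$ is fixed; $\mathcal O_B$ means that the implied constant may depend on $B$ (and on the fixed law of $X$). *)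

theory Defs
  imports "HOL-Probability.Probability" "HOL-Number_Theory.Number_Theory"
begin

definition symmetric_rv :: "'a measure \<Rightarrow> ('a \<Rightarrow> real) \<Rightarrow> bool" where
  "symmetric_rv M X \<longleftrightarrow>
     X \<in> borel_measurable M \<and> distr M borel (\<lambda>\<omega>. - X \<omega>) = distr M borel X"

definition independent_copies :: "'a measure \<Rightarrow> ('a \<Rightarrow> real) \<Rightarrow> (nat \<Rightarrow> 'a \<Rightarrow> real) \<Rightarrow> bool" where
  "independent_copies M X Xs \<longleftrightarrow>
     prob_space.indep_vars M (\<lambda>_. borel) Xs {1..} \<and>
     (\<forall>i\<ge>1. distr M borel (Xs i) = distr M borel X)"

text \<open>The random variables are real-valued and not assumed to be integer-valued, so being prime
  includes being an integer. Negative primes count, hence the absolute value.\<close>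

definition prime_in_class :: "real \<Rightarrow> int \<Rightarrow> nat \<Rightarrow> bool" where
  "prime_in_class s l k \<longleftrightarrow> (\<exists>r::int. s = of_int r \<and> prime \<bar>r\<bar> \<and> [r = l] (mod int k))"

end

theory Submission
  imports Defs "HOL-Real_Asymp.Real_Asymp"
begin

text \<open>
  Put \<open>x = 2 \<surd>(B n log log n)\<close>. Cutting the summands off at height \<open>2 n / x\<close> and bounding
  exponential moments shows that \<open>\<bar>S\<^sub>n\<bar> \<ge> x\<close> has probability \<open>O((log n)\<^sup>-\<^sup>B)\<close>. Every single value
  is taken by \<open>S\<^sub>n\<close> with probability \<open>O(1 / \<surd>n)\<close>, because the characteristic function of \<open>X\<close> is at
  most \<open>exp (- t\<^sup>2 / 4)\<close> near 0. It remains to count the primes of size at most \<open>x\<close> in the residue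
  class. Selberg's sieve with sifting level \<open>z = n\<^sup>1\<^sup>/\<^sup>1\<^sup>6\<close> bounds their number by
  \<open>O(x / (\<phi>(k) log n)) + O(z\<^sup>4)\<close> uniformly in \<open>k\<close>, and the second term, divided by \<open>\<surd>n\<close>, is
  smaller than any negative power of \<open>log n\<close>.
\<close>

section \<open>Selberg's sieve\<close>

text \<open>The union bound multiplies the number of admissible primes by the largest point mass, so
  an upper bound for that number is enough. It must be a sieve bound, since \<open>k\<close> may
  grow almost as fast as the interval itself, out of reach of asymptotic formulas for primes in
  progressions. The sieve remainder stays free of \<open>k\<close> because a progression meets an
  interval in its expected number of points up to an error of 1, whatever the modulus.

  The law of \<open>X\<close> need not live on a lattice, so point masses cannot be read off from
  Fourier inversion over one period; a nonnegative trigonometric kernel bounds them using the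
  characteristic function near 0 only. Exponential moments of \<open>X\<close> may be infinite,
  hence the cut-off. Its loss is paid for by the third absolute moment and has order (log log
  n)^(3/2) / sqrt n. Symmetry keeps the cut-off variables centred. The factor sqrt (log log n) in
  the result is, up to a constant, \<open>x / sqrt n\<close>: the price of a tail as small as (log
  n)^(-B).\<close>

lemma sum_between_alternating:
  assumes "finite T" "E \<subseteq> T"
  shows "(\<Sum>S | E \<subseteq> S \<and> S \<subseteq> T. (-1) ^ card S) = (if E = T then (-1) ^ card E else (0::real))"
proof -
  have fin: "finite (T - E)" "finite E" using assms finite_subset by auto
  have "(\<Sum>S | E \<subseteq> S \<and> S \<subseteq> T. (-1) ^ card S) = (\<Sum>X\<in>Pow (T - E). (-1) ^ card (E \<union> X) :: real)"
    using assms(2)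
    by (intro sum.reindex_bij_witness[of _ "\<lambda>X. E \<union> X" "\<lambda>S. S - E"])
       (auto simp: Un_absorb1)
  also have "\<dots> = (\<Sum>X\<in>Pow (T - E). (-1) ^ card E * (-1) ^ card X)"
  proof (rule sum.cong)
    fix X assume "X \<in> Pow (T - E)"
    then have "card (E \<union> X) = card E + card X"
      using fin by (intro card_Un_disjoint) (auto intro: finite_subset)
    then show "(-1) ^ card (E \<union> X) = (-1) ^ card E * ((-1) ^ card X :: real)"
      by (simp add: power_add)
  qed simp
  also have "\<dots> = (-1) ^ card E * (\<Sum>X\<in>Pow (T - E). (-1) ^ card X)"
    by (simp add: sum_distrib_left)
  also have "(\<Sum>X\<in>Pow (T - E). (-1) ^ card X) = (\<Prod>x\<in>T-E. (1::real) - 1)"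
    using prod_diff_conv_sum[where A = "T - E" and ?f1.0 = "\<lambda>_. 1::real" and ?f2.0 = "\<lambda>_. 1"] fin(1) by simp
  also have "\<dots> = (if E = T then 1 else 0)"
    using assms fin by (auto simp: power_0_left)
  finally show ?thesis by (simp split: if_splits)
qed

text \<open>A squarefree number is encoded by the set of its prime factors.\<close>

definition phi_prod :: "nat set \<Rightarrow> real" where
  "phi_prod S = (\<Prod>p\<in>S. real p - 1)"

definition sieve_family :: "nat set \<Rightarrow> nat \<Rightarrow> nat set set" where
  "sieve_family P z = {S. S \<subseteq> P \<and> \<Prod>S \<le> z}"

text \<open>The classical G: the sum of 1/phi(d) over the squarefree d up to \<open>z\<close>
  composed of primes in \<open>P\<close>.\<close>

definition selberg_sum :: "nat set \<Rightarrow> nat \<Rightarrow> real" where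
  "selberg_sum P z = (\<Sum>S\<in>sieve_family P z. 1 / phi_prod S)"

text \<open>These weights minimise the quadratic form in \<open>selberg_quadratic_form\<close> below: they are found by
  prescribing the values \<open>\<mu>(e) / (\<phi>(e) G)\<close> for the diagonal variables in
  \<open>sum_selberg_weight_over\<close> and inverting.\<close>

definition selberg_weight :: "nat set \<Rightarrow> nat \<Rightarrow> nat set \<Rightarrow> real" where
  "selberg_weight P z S = real (\<Prod>S) * (-1) ^ card S *
     (\<Sum>T | T \<in> sieve_family P z \<and> S \<subseteq> T. 1 / phi_prod T) / selberg_sum P z"

lemma phi_prod_pos: "(\<And>p. p \<in> S \<Longrightarrow> prime p) \<Longrightarrow> phi_prod S > 0"
  unfolding phi_prod_def using prime_gt_1_nat by (intro prod_pos) fastforce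

lemma finite_sieve_family: "finite P \<Longrightarrow> finite (sieve_family P z)"
  by (rule finite_subset[of _ "Pow P"]) (auto simp: sieve_family_def)

lemma dvd_prod_primes_iff:
  fixes S :: "nat set" and p :: nat
  assumes "finite S" "\<And>q. q \<in> S \<Longrightarrow> prime q" "prime p"
  shows "p dvd \<Prod>S \<longleftrightarrow> p \<in> S"
proof -
  have "p dvd \<Prod>S \<longleftrightarrow> (\<exists>q\<in>S. p dvd q)"
    using prime_dvd_prod_iff[OF assms(1,3), of "\<lambda>q. q"] by simp
  also have "\<dots> \<longleftrightarrow> p \<in> S"
    by (metis assms(2,3) dvd_refl primes_dvd_imp_eq)
  finally show ?thesis .
qed

lemma prod_primes_inj_on:
  assumes "finite P" "\<And>p::nat. p \<in> P \<Longrightarrow> prime p"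
  shows "inj_on (\<lambda>S. \<Prod>S) (Pow P)"
proof (rule inj_onI)
  fix S T assume *: "S \<in> Pow P" "T \<in> Pow P" "\<Prod>S = \<Prod>T"
  have "finite S" "finite T" using * assms(1) finite_subset by auto
  then have "p \<in> S \<longleftrightarrow> p \<in> T" if "p \<in> P" for p
    using dvd_prod_primes_iff[of S p] dvd_prod_primes_iff[of T p] * assms(2) that
    by (metis PowD subsetD)
  then show "S = T" using * by auto
qed

text \<open>Closure under divisors: Moebius inversion and the expansion of a gcd into a divisor sum
  both stay inside the family.\<close>

lemma sieve_family_subset:
  assumes "finite P" "\<And>p. p \<in> P \<Longrightarrow> prime p" "T \<subseteq> S" "S \<in> sieve_family P z"
  shows "T \<in> sieve_family P z"
proof -
  have "finite S" "S \<subseteq> P" using assms(1,4) by (auto simp: sieve_family_def intro: finite_subset)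
  have "\<Prod>T dvd \<Prod>S" using \<open>finite S\<close> assms(3) by (rule prod_dvd_prod_subset)
  moreover have "\<Prod>S > 0" using \<open>S \<subseteq> P\<close> assms(2) prime_gt_0_nat by (intro prod_pos) auto
  ultimately have "\<Prod>T \<le> \<Prod>S" by (intro dvd_imp_le) auto
  then show ?thesis using assms(3,4) by (auto simp: sieve_family_def)
qed

lemma selberg_sum_pos:
  assumes "finite P" "\<And>p. p \<in> P \<Longrightarrow> prime p" "z \<ge> 1"
  shows "selberg_sum P z > 0"
proof -
  have "1 / phi_prod {} \<le> selberg_sum P z"
    unfolding selberg_sum_def
  proof (rule member_le_sum)
    show "{} \<in> sieve_family P z" using assms(3) by (simp add: sieve_family_def)
    show "0 \<le> 1 / phi_prod S" if "S \<in> sieve_family P z - {{}}" for S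
    proof -
      have "phi_prod S > 0" by (rule phi_prod_pos) (use that assms(2) in \<open>auto simp: sieve_family_def\<close>)
      then show ?thesis by simp
    qed
  qed (simp add: finite_sieve_family assms(1))
  then show ?thesis by (simp add: phi_prod_def)
qed

lemma selberg_weight_empty:
  assumes "finite P" "\<And>p. p \<in> P \<Longrightarrow> prime p" "z \<ge> 1"
  shows "selberg_weight P z {} = 1"
  using selberg_sum_pos[OF assms] by (simp add: selberg_weight_def selberg_sum_def)

text \<open>Apart from the product and the sign, a weight is a subsum of G divided by G, hence lies
  in [0,1]. The classical bound is 1; this cruder one leads to a remainder \<open>z ^ 4\<close>
  instead of \<open>z ^ 2\<close>, which is affordable because \<open>z\<close> will be a small
  power of n.\<close>

lemma abs_selberg_weight_le:
  assumes "finite P" "\<And>p. p \<in> P \<Longrightarrow> prime p" "z \<ge> 1"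
  shows "\<bar>selberg_weight P z S\<bar> \<le> real (\<Prod>S)"
proof -
  let ?s = "\<Sum>T | T \<in> sieve_family P z \<and> S \<subseteq> T. 1 / phi_prod T"
  have pos: "phi_prod T > 0" if "T \<in> sieve_family P z" for T
    by (rule phi_prod_pos) (use that assms(2) in \<open>auto simp: sieve_family_def\<close>)
  have "?s \<le> selberg_sum P z"
    unfolding selberg_sum_def using pos
    by (intro sum_mono2 finite_sieve_family assms(1)) (auto intro: less_imp_le)
  moreover have "?s \<ge> 0" using pos by (intro sum_nonneg) (auto intro: less_imp_le)
  ultimately have "?s / selberg_sum P z \<le> 1" "?s / selberg_sum P z \<ge> 0"
    using selberg_sum_pos[OF assms] by auto
  then have "\<bar>?s / selberg_sum P z\<bar> \<le> 1" by simp
  then have "real (\<Prod>S) * \<bar>?s / selberg_sum P z\<bar> \<le> real (\<Prod>S) * 1"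
    by (rule mult_left_mono) (rule of_nat_0_le_iff)
  moreover have "\<bar>selberg_weight P z S\<bar> = real (\<Prod>S) * \<bar>?s / selberg_sum P z\<bar>"
    unfolding selberg_weight_def times_divide_eq_right[symmetric] abs_mult power_abs
      abs_of_nonneg[OF of_nat_0_le_iff[of "\<Prod>S"]] by simp
  ultimately show ?thesis by simp
qed

text \<open>Moebius inversion on the lattice of subsets: once the sums are exchanged, the signs of
  all \<open>S\<close> between \<open>E\<close> and \<open>T\<close> cancel unless
  \<open>E = T\<close>.\<close>

lemma sum_selberg_weight_over:
  assumes "finite P" "\<And>p. p \<in> P \<Longrightarrow> prime p" "z \<ge> 1" "E \<in> sieve_family P z"
  shows "(\<Sum>S | S \<in> sieve_family P z \<and> E \<subseteq> S. selberg_weight P z S / real (\<Prod>S))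
           = (-1) ^ card E / (phi_prod E * selberg_sum P z)"
proof -
  let ?F = "sieve_family P z" and ?G = "selberg_sum P z"
  have fin: "finite ?F" by (rule finite_sieve_family) (rule assms)
  then have fin': "finite {S. S \<in> ?F \<and> E \<subseteq> S}" by simp
  have nz: "real (\<Prod>S) \<noteq> 0" if "S \<in> ?F" for S
  proof -
    have "\<Prod>S > 0" using that assms(2) prime_gt_0_nat
      by (intro prod_pos) (auto simp: sieve_family_def)
    then show ?thesis by linarith
  qed
  have "(\<Sum>S | S \<in> ?F \<and> E \<subseteq> S. selberg_weight P z S / real (\<Prod>S))
      = (\<Sum>S | S \<in> ?F \<and> E \<subseteq> S. \<Sum>T | T \<in> ?F \<and> S \<subseteq> T. (-1) ^ card S / (phi_prod T * ?G))"
    using nz by (intro sum.cong)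
      (auto simp: selberg_weight_def sum_distrib_left sum_divide_distrib divide_simps)
  also have "\<dots> = (\<Sum>T\<in>?F. \<Sum>S | S \<in> {S. S \<in> ?F \<and> E \<subseteq> S} \<and> S \<subseteq> T. (-1) ^ card S / (phi_prod T * ?G))"
    by (rule sum.swap_restrict[OF fin' fin,
      where R = "(\<subseteq>)" and g = "\<lambda>S T. (-1) ^ card S / (phi_prod T * ?G)"])
  also have "\<dots> = (\<Sum>T\<in>?F. if E = T then (-1) ^ card E / (phi_prod T * ?G) else 0)"
  proof (rule sum.cong)
    fix T assume T: "T \<in> ?F"
    then have finT: "finite T" using assms(1) by (auto simp: sieve_family_def intro: finite_subset)
    have eq: "{S. S \<in> {S. S \<in> ?F \<and> E \<subseteq> S} \<and> S \<subseteq> T} = {S. E \<subseteq> S \<and> S \<subseteq> T}"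
      using sieve_family_subset[OF assms(1,2) _ T] by auto
    show "(\<Sum>S | S \<in> {S. S \<in> ?F \<and> E \<subseteq> S} \<and> S \<subseteq> T. (-1) ^ card S / (phi_prod T * ?G))
      = (if E = T then (-1) ^ card E / (phi_prod T * ?G) else 0)"
    proof (cases "E \<subseteq> T")
      case True
      then show ?thesis unfolding eq sum_divide_distrib[symmetric]
        by (subst sum_between_alternating) (auto simp: finT)
    next
      case False
      then have *: "{S. E \<subseteq> S \<and> S \<subseteq> T} = {}" by blast
      from False have "E \<noteq> T" by blast
      then show ?thesis unfolding eq * by simp
    qed
  qed simp
  also have "\<dots> = (-1) ^ card E / (phi_prod E * ?G)"
    using fin assms(4) by simp
  finally show ?thesis .
qed

text \<open>For squarefree m this is the identity that phi(d) summed over the divisors d of m gives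
  m. Applied to a gcd, it separates the two variables of the quadratic form.\<close>

lemma prod_eq_sum_phi_prod:
  "finite S \<Longrightarrow> real (\<Prod>S) = (\<Sum>T\<in>Pow S. phi_prod T)"
  using prod_add[of S "\<lambda>p. real p - 1" "\<lambda>_. 1"] by (simp add: phi_prod_def)

text \<open>Union and intersection play the roles of lcm and gcd. Replacing 1/lcm by gcd over the
  product and expanding the gcd turns the form into a sum of squares with coefficients phi(T).
  Inserting the prescribed diagonal values leaves the sum of 1/(phi(T) G^2), which is 1/G.\<close>

lemma selberg_quadratic_form:
  assumes "finite P" "\<And>p. p \<in> P \<Longrightarrow> prime p" "z \<ge> 1"
  shows "(\<Sum>S\<in>sieve_family P z. \<Sum>S'\<in>sieve_family P z.
            selberg_weight P z S * selberg_weight P z S' / real (\<Prod>(S \<union> S'))) = 1 / selberg_sum P z"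
proof -
  let ?F = "sieve_family P z" and ?G = "selberg_sum P z"
  define a where "a = (\<lambda>S. selberg_weight P z S / real (\<Prod>S))"
  have fin: "finite ?F" by (rule finite_sieve_family) (rule assms)
  have G: "?G > 0" by (rule selberg_sum_pos) fact+
  have finS: "finite S" if "S \<in> ?F" for S
    using that assms(1) by (auto simp: sieve_family_def intro: finite_subset)
  have nz: "real (\<Prod>S) \<noteq> 0" if "S \<subseteq> P" for S
  proof -
    have "\<Prod>S > 0" using that assms(2) prime_gt_0_nat by (intro prod_pos) auto
    then show ?thesis by linarith
  qed
  have phi: "phi_prod T > 0" if "T \<in> ?F" for T
    by (rule phi_prod_pos) (use that assms(2) in \<open>auto simp: sieve_family_def\<close>)
  have "(\<Sum>S\<in>?F. \<Sum>S'\<in>?F. selberg_weight P z S * selberg_weight P z S' / real (\<Prod>(S \<union> S')))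
      = (\<Sum>S\<in>?F. \<Sum>S'\<in>?F. \<Sum>T\<in>?F. if T \<subseteq> S \<and> T \<subseteq> S' then a S * a S' * phi_prod T else 0)"
  proof (intro sum.cong refl)
    fix S S' assume S: "S \<in> ?F" "S' \<in> ?F"
    have *: "real (\<Prod>(S \<union> S')) * real (\<Prod>(S \<inter> S')) = real (\<Prod>S) * real (\<Prod>S')"
      unfolding of_nat_mult[symmetric] using prod.union_inter[of S S' "\<lambda>x. x"] finS S by simp
    have SP: "S \<union> S' \<subseteq> P" "S \<subseteq> P" "S' \<subseteq> P" using S by (auto simp: sieve_family_def)
    have "selberg_weight P z S * selberg_weight P z S' / real (\<Prod>(S \<union> S'))
        = a S * a S' * real (\<Prod>(S \<inter> S'))"
      using * nz[OF SP(1)] nz[OF SP(2)] nz[OF SP(3)] by (simp add: a_def field_simps)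
    also have "real (\<Prod>(S \<inter> S')) = (\<Sum>T\<in>Pow (S \<inter> S'). phi_prod T)"
      using finS S by (intro prod_eq_sum_phi_prod) auto
    also have "Pow (S \<inter> S') = {T \<in> ?F. T \<subseteq> S \<and> T \<subseteq> S'}"
      using sieve_family_subset[OF assms(1,2) _ S(1)] by auto
    finally show "selberg_weight P z S * selberg_weight P z S' / real (\<Prod>(S \<union> S'))
        = (\<Sum>T\<in>?F. if T \<subseteq> S \<and> T \<subseteq> S' then a S * a S' * phi_prod T else 0)"
      using fin by (simp add: sum_distrib_left sum.inter_filter if_distrib cong: if_cong)
  qed
  also have "\<dots> = (\<Sum>T\<in>?F. \<Sum>S\<in>?F. \<Sum>S'\<in>?F. if T \<subseteq> S \<and> T \<subseteq> S' then a S * a S' * phi_prod T else 0)"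
    by (subst sum.swap[of _ ?F ?F], subst (2) sum.swap, rule refl)
  also have "\<dots> = (\<Sum>T\<in>?F. phi_prod T * (\<Sum>S | S \<in> ?F \<and> T \<subseteq> S. a S)\<^sup>2)"
  proof (intro sum.cong refl)
    fix T
    have "(\<Sum>S | S \<in> ?F \<and> T \<subseteq> S. a S) = (\<Sum>S\<in>?F. if T \<subseteq> S then a S else 0)"
      using fin by (simp add: sum.inter_filter)
    then have "(\<Sum>S | S \<in> ?F \<and> T \<subseteq> S. a S)\<^sup>2
      = (\<Sum>S\<in>?F. \<Sum>S'\<in>?F. (if T \<subseteq> S then a S else 0) * (if T \<subseteq> S' then a S' else 0))"
      by (simp add: power2_eq_square sum_product)
    then show "(\<Sum>S\<in>?F. \<Sum>S'\<in>?F. if T \<subseteq> S \<and> T \<subseteq> S' then a S * a S' * phi_prod T else 0)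
      = phi_prod T * (\<Sum>S | S \<in> ?F \<and> T \<subseteq> S. a S)\<^sup>2"
      by (simp add: sum_distrib_left) (intro sum.cong refl, simp)
  qed
  also have "\<dots> = (\<Sum>T\<in>?F. 1 / phi_prod T / ?G\<^sup>2)"
  proof (intro sum.cong refl)
    fix T assume T: "T \<in> ?F"
    have "phi_prod T * ((-1) ^ card T / (phi_prod T * ?G))\<^sup>2 = 1 / phi_prod T / ?G\<^sup>2"
      using phi[OF T] G by (simp add: power_divide power_mult_distrib field_simps power2_eq_square
          flip: power_add)
    then show "phi_prod T * (\<Sum>S | S \<in> ?F \<and> T \<subseteq> S. a S)\<^sup>2 = 1 / phi_prod T / ?G\<^sup>2"
      using sum_selberg_weight_over[OF assms T] by (simp add: a_def)
  qed
  also have "\<dots> = 1 / ?G"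
    unfolding sum_divide_distrib[symmetric] selberg_sum_def[symmetric]
    using G by (simp add: power2_eq_square)
  finally show ?thesis .
qed

text \<open>The squared weight sum is never negative, and it is 1 at an unsifted \<open>m\<close>,
  where only the empty set contributes. Summing it over all of \<open>A\<close> therefore overcounts
  the unsifted elements. The expected densities produce the quadratic form, and the errors, at most
  1 for each pair, produce \<open>z ^ 4\<close>.\<close>

theorem selberg_sieve:
  fixes A :: "int set" and X :: real
  assumes "finite P" "\<And>p. p \<in> P \<Longrightarrow> prime p" "z \<ge> 1" "finite A"
    and dens: "\<And>S. S \<subseteq> P \<Longrightarrow> \<bar>real (card {m\<in>A. \<forall>p\<in>S. int p dvd m}) - X / real (\<Prod>S)\<bar> \<le> 1"
  shows "real (card {m\<in>A. \<forall>p\<in>P. \<not> int p dvd m}) \<le> X / selberg_sum P z + real z ^ 4"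
proof -
  let ?F = "sieve_family P z"
  define w where "w = selberg_weight P z"
  define D where "D = (\<lambda>S m. \<forall>p\<in>S. int p dvd m)"
  define r where "r = (\<lambda>S. real (card {m\<in>A. D S m}) - X / real (\<Prod>S))"
  have fin: "finite ?F" by (rule finite_sieve_family) (rule assms)
  have w_empty: "w {} = 1" unfolding w_def by (rule selberg_weight_empty) fact+
  have w_le: "\<bar>w S\<bar> \<le> real z" if "S \<in> ?F" for S
  proof -
    have "\<bar>w S\<bar> \<le> real (\<Prod>S)" unfolding w_def by (rule abs_selberg_weight_le) fact+
    also have "\<dots> \<le> real z" using that by (simp add: sieve_family_def flip: of_nat_prod)
    finally show ?thesis .
  qed
  have "real (card {m\<in>A. \<forall>p\<in>P. \<not> int p dvd m}) = (\<Sum>m\<in>{m\<in>A. \<forall>p\<in>P. \<not> int p dvd m}. 1)"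
    by simp
  also have "\<dots> \<le> (\<Sum>m\<in>{m\<in>A. \<forall>p\<in>P. \<not> int p dvd m}. (\<Sum>S\<in>?F. if D S m then w S else 0)\<^sup>2)"
  proof (rule sum_mono)
    fix m assume m: "m \<in> {m\<in>A. \<forall>p\<in>P. \<not> int p dvd m}"
    have "(\<Sum>S\<in>?F. if D S m then w S else 0) = (\<Sum>S\<in>?F. if S = {} then w S else 0)"
      using m by (intro sum.cong) (auto simp: D_def sieve_family_def)
    also have "\<dots> = 1" using fin w_empty assms(3) by (simp add: sieve_family_def)
    finally show "1 \<le> (\<Sum>S\<in>?F. if D S m then w S else 0)\<^sup>2" by simp
  qed
  also have "\<dots> \<le> (\<Sum>m\<in>A. (\<Sum>S\<in>?F. if D S m then w S else 0)\<^sup>2)"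
    using assms(4) by (intro sum_mono2) auto
  also have "\<dots> = (\<Sum>m\<in>A. \<Sum>S\<in>?F. \<Sum>S'\<in>?F. if D (S \<union> S') m then w S * w S' else 0)"
    unfolding power2_eq_square sum_product by (intro sum.cong refl) (auto simp: D_def)
  also have "\<dots> = (\<Sum>S\<in>?F. \<Sum>S'\<in>?F. \<Sum>m\<in>A. if D (S \<union> S') m then w S * w S' else 0)"
    by (subst sum.swap, subst (2) sum.swap, rule refl)
  also have "\<dots> = (\<Sum>S\<in>?F. \<Sum>S'\<in>?F. w S * w S' * (X / real (\<Prod>(S \<union> S')) + r (S \<union> S')))"
    using assms(4) by (intro sum.cong refl)
      (simp add: sum.inter_filter[symmetric] r_def mult.commute)
  also have "\<dots> = X * (\<Sum>S\<in>?F. \<Sum>S'\<in>?F. w S * w S' / real (\<Prod>(S \<union> S')))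
      + (\<Sum>S\<in>?F. \<Sum>S'\<in>?F. w S * w S' * r (S \<union> S'))"
    by (simp add: distrib_left sum.distrib sum_distrib_left mult_ac)
  also have "(\<Sum>S\<in>?F. \<Sum>S'\<in>?F. w S * w S' / real (\<Prod>(S \<union> S'))) = 1 / selberg_sum P z"
    unfolding w_def by (rule selberg_quadratic_form) fact+
  also have "(\<Sum>S\<in>?F. \<Sum>S'\<in>?F. w S * w S' * r (S \<union> S')) \<le> (\<Sum>S\<in>?F. \<Sum>S'\<in>?F. real z * real z)"
  proof (intro sum_mono)
    fix S S' assume S: "S \<in> ?F" "S' \<in> ?F"
    have "\<bar>r (S \<union> S')\<bar> \<le> 1"
      unfolding r_def D_def using S by (intro dens) (auto simp: sieve_family_def)
    then have "\<bar>w S\<bar> * \<bar>w S'\<bar> * \<bar>r (S \<union> S')\<bar> \<le> real z * real z * 1"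
      using w_le[OF S(1)] w_le[OF S(2)] by (intro mult_mono) auto
    then show "w S * w S' * r (S \<union> S') \<le> real z * real z"
      by (simp add: abs_mult[symmetric])
  qed
  also have "\<dots> = (real (card ?F))\<^sup>2 * (real z)\<^sup>2" by (simp add: power2_eq_square)
  also have "\<dots> \<le> (real z)\<^sup>2 * (real z)\<^sup>2"
  proof -
    \<comment> \<open>By unique factorisation, distinct members of the family have distinct products
      in \<open>{1..z}\<close>, so there are at most \<open>z\<close> of them.\<close>
    have "card ?F = card ((\<lambda>S. \<Prod>S) ` ?F)"
      using prod_primes_inj_on[OF assms(1,2)]
      by (intro card_image[symmetric]) (auto simp: sieve_family_def intro: inj_on_subset)
    also have "\<dots> \<le> card {1..z}"
    proof (rule card_mono)
      show "(\<lambda>S. \<Prod>S) ` ?F \<subseteq> {1..z}"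
      proof
        fix n assume "n \<in> (\<lambda>S. \<Prod>S) ` ?F"
        then obtain S where S: "S \<subseteq> P" "\<Prod>S \<le> z" "n = \<Prod>S" by (auto simp: sieve_family_def)
        have "\<Prod>S > 0" using S assms(2) prime_gt_0_nat by (intro prod_pos) auto
        then show "n \<in> {1..z}" using S by auto
      qed
    qed simp
    finally show ?thesis by (intro mult_right_mono power_mono) auto
  qed
  finally show ?thesis by simp
qed

section \<open>Primes in residue classes\<close>

lemma card_residue_class_interval:
  fixes N a q :: int
  assumes "N \<ge> 0" "q > 0"
  shows "\<bar>real (card {m\<in>{-N..N}. [m = a] (mod q)}) - (2 * real_of_int N + 1) / q\<bar> \<le> 1"
proof -
  \<comment> \<open>The count becomes \<open>v - u\<close>. Starting at \<open>- N - 1\<close> makes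
    the half-open range of \<open>j\<close> include the left end \<open>- N\<close>, and makes the
    two arguments of the floors differ by exactly \<open>(2 * N + 1) / q\<close>.\<close>
  define u where "u = \<lfloor>(- real_of_int N - 1 - a) / q\<rfloor>"
  define v where "v = \<lfloor>(real_of_int N - a) / q\<rfloor>"
  have q: "real_of_int q > 0" using assms by simp
  have le_v: "j \<le> v \<longleftrightarrow> a + q * j \<le> N" for j
  proof -
    have "j \<le> v \<longleftrightarrow> real_of_int j * q \<le> real_of_int N - a"
      unfolding v_def le_floor_iff using q by (simp add: pos_le_divide_eq)
    also have "\<dots> \<longleftrightarrow> real_of_int (a + q * j) \<le> real_of_int N" by (simp add: algebra_simps)
    finally show ?thesis by (simp only: of_int_le_iff)
  qed
  have u_less: "u < j \<longleftrightarrow> - N \<le> a + q * j" for j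
  proof -
    have "u < j \<longleftrightarrow> - real_of_int N - 1 - a < real_of_int j * q"
      unfolding u_def floor_less_iff using q by (simp add: pos_divide_less_eq)
    also have "\<dots> \<longleftrightarrow> real_of_int (- N - 1) < real_of_int (a + q * j)" by (simp add: algebra_simps)
    finally show ?thesis by (simp only: of_int_less_iff) auto
  qed
  have "{m\<in>{-N..N}. [m = a] (mod q)} = (\<lambda>j. a + q * j) ` {u<..v}"
  proof (intro equalityI subsetI)
    fix m assume m: "m \<in> {m\<in>{-N..N}. [m = a] (mod q)}"
    then obtain j where j: "m = a + q * j"
      by (metis (no_types, lifting) cong_iff_lin cong_sym mem_Collect_eq)
    then show "m \<in> (\<lambda>j. a + q * j) ` {u<..v}" using m le_v u_less by auto
  next
    fix m assume "m \<in> (\<lambda>j. a + q * j) ` {u<..v}"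
    then show "m \<in> {m\<in>{-N..N}. [m = a] (mod q)}" using le_v u_less by (auto simp: cong_def)
  qed
  then have "card {m\<in>{-N..N}. [m = a] (mod q)} = card {u<..v}"
    using assms by (simp add: card_image inj_on_def)
  moreover have "u \<le> v" unfolding u_def v_def using assms q
    by (intro floor_mono divide_right_mono) auto
  ultimately have card: "real (card {m\<in>{-N..N}. [m = a] (mod q)}) = real_of_int v - u" by simp
  have "real_of_int v \<le> (real_of_int N - a) / q" "(real_of_int N - a) / q < real_of_int v + 1"
    "real_of_int u \<le> (- real_of_int N - 1 - a) / q" "(- real_of_int N - 1 - a) / q < real_of_int u + 1"
    unfolding u_def v_def by linarith+
  moreover have "(2 * real_of_int N + 1) / q = (real_of_int N - a) / q - (- real_of_int N - 1 - a) / q"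
    by (simp add: diff_divide_distrib[symmetric])
  ultimately show ?thesis unfolding card by linarith
qed

lemma prod_primes_dvd_iff:
  fixes S :: "nat set" and m :: int
  assumes "finite S" "\<And>p. p \<in> S \<Longrightarrow> prime p"
  shows "int (\<Prod>S) dvd m \<longleftrightarrow> (\<forall>p\<in>S. int p dvd m)"
  using assms
proof (induction S rule: finite_induct)
  case (insert p S)
  have "coprime p (\<Prod>S)"
    using insert by (intro prod_coprime_right) (metis insertCI primes_coprime)
  then have "coprime (int p) (int (\<Prod>S))" by (simp only: coprime_int_iff)
  then have "int p * int (\<Prod>S) dvd m \<longleftrightarrow> int p dvd m \<and> int (\<Prod>S) dvd m"
    by (metis divides_mult dvd_mult_left dvd_mult_right)
  with insert show ?case by simp
qed simp

text \<open>Every prime of \<open>S\<close> divides \<open>n\<close> at least once, so the terms are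
  among those of the expanded product over \<open>p\<close> in \<open>S\<close> of the geometric
  series 1/p + 1/p^2 + ..., whose value is 1/(p - 1).\<close>

lemma sum_inverse_same_prime_factors_le:
  assumes "finite A" "\<And>n. n \<in> A \<Longrightarrow> n > 0 \<and> prime_factors n = S"
    and "finite S" "\<And>p. p \<in> S \<Longrightarrow> prime p"
  shows "(\<Sum>n\<in>A. 1 / real n) \<le> 1 / phi_prod S"
proof -
  \<comment> \<open>Restricting the exponent vector to \<open>S\<close> makes it an element of a
    \<open>PiE\<close>. The sum \<open>K\<close> of all elements of \<open>A\<close> serves as one
    common upper bound for the exponents, since each is smaller than its \<open>n\<close>.\<close>
  define g where "g = (\<lambda>n::nat. restrict (\<lambda>p. multiplicity p n) S)"
  define K where "K = (\<Sum>n\<in>A. n)"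
  have n_eq: "n = (\<Prod>p\<in>S. p ^ g n p)" if "n \<in> A" for n
    using prime_factorization_nat[of n] assms(2)[OF that] by (auto simp: g_def intro!: prod.cong)
  have inj: "inj_on g A"
  proof (rule inj_onI)
    fix m n assume "m \<in> A" "n \<in> A" "g m = g n"
    then show "m = n" using n_eq[of m] n_eq[of n] by simp
  qed
  have g_in: "g n \<in> PiE S (\<lambda>_. {1..K})" if n: "n \<in> A" for n
  proof -
    have "1 \<le> multiplicity p n \<and> multiplicity p n \<le> K" if p: "p \<in> S" for p
    proof
      show "1 \<le> multiplicity p n"
        using assms(2)[OF n] p by (auto simp: prime_factors_multiplicity)
      have "multiplicity p n < p ^ multiplicity p n"
        using assms(4)[OF p] by (intro power_gt_expt) (rule prime_gt_Suc_0_nat)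
      also have "\<dots> \<le> n" using assms(2)[OF n] by (intro dvd_imp_le multiplicity_dvd) auto
      also have "n \<le> K" unfolding K_def using n assms(1) by (intro member_le_sum) auto
      finally show "multiplicity p n \<le> K" by simp
    qed
    then show ?thesis by (auto simp: g_def)
  qed
  have "(\<Sum>n\<in>A. 1 / real n) = (\<Sum>n\<in>A. \<Prod>p\<in>S. (1 / real p) ^ g n p)"
  proof (rule sum.cong)
    fix n assume "n \<in> A"
    then have "real n = (\<Prod>p\<in>S. real p ^ g n p)"
      using n_eq[of n] by (metis (no_types, lifting) of_nat_power of_nat_prod prod.cong)
    then show "1 / real n = (\<Prod>p\<in>S. (1 / real p) ^ g n p)"
      by (simp add: power_one_over prod_dividef)
  qed simp
  also have "\<dots> = (\<Sum>f\<in>g ` A. \<Prod>p\<in>S. (1 / real p) ^ f p)"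
    using inj by (simp add: sum.reindex)
  also have "\<dots> \<le> (\<Sum>f\<in>PiE S (\<lambda>_. {1..K}). \<Prod>p\<in>S. (1 / real p) ^ f p)"
    using g_in assms(3) by (intro sum_mono2 finite_PiE prod_nonneg) auto
  also have "\<dots> = (\<Prod>p\<in>S. \<Sum>a\<in>{1..K}. (1 / real p) ^ a)"
    using assms(3) by (intro prod_sum_PiE[symmetric]) auto
  also have "\<dots> \<le> (\<Prod>p\<in>S. 1 / (real p - 1))"
  proof (rule prod_mono)
    fix p assume "p \<in> S"
    then have p: "real p > 1" using assms(4) prime_gt_1_nat by fastforce
    have "(\<Sum>a\<in>{1..K}. (1 / real p) ^ a) \<le> 1 / (real p - 1)"
    proof -
      define c where "c = 1 / real p"
      have c: "c * real p = 1" using p by (simp add: c_def)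
      have "(\<Sum>a\<in>{1..K}. c ^ a) * (real p - 1) = 1 - c ^ K"
      proof (induction K)
        case (Suc K)
        have "(\<Sum>a\<in>{1..Suc K}. c ^ a) * (real p - 1)
            = (\<Sum>a\<in>{1..K}. c ^ a) * (real p - 1) + c ^ K * (c * real p) - c ^ Suc K"
          by (simp add: algebra_simps)
        then show ?case unfolding Suc c by simp
      qed simp
      then have "(\<Sum>a\<in>{1..K}. (1 / real p) ^ a) = (1 - (1 / real p) ^ K) / (real p - 1)"
        using p by (simp add: c_def eq_divide_eq)
      also have "\<dots> \<le> 1 / (real p - 1)"
        using p by (intro divide_right_mono) auto
      finally show ?thesis .
    qed
    then show "0 \<le> (\<Sum>a\<in>{1..K}. (1 / real p) ^ a) \<and> (\<Sum>a\<in>{1..K}. (1 / real p) ^ a) \<le> 1 / (real p - 1)"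
      by (simp add: sum_nonneg)
  qed
  also have "\<dots> = 1 / phi_prod S" by (simp add: phi_prod_def prod_dividef)
  finally show ?thesis .
qed

text \<open>The harmonic sum up to \<open>z\<close>, which is at least ln z, is grouped by the set
  of prime factors. This set has product at most n \<le> z and so belongs to the family; each group
  contributes at most the corresponding term of G.\<close>

lemma ln_le_selberg_sum_all_primes:
  assumes "z \<ge> 1"
  shows "ln (real z) \<le> selberg_sum {p. prime p \<and> p \<le> z} z"
proof -
  let ?F = "sieve_family {p. prime p \<and> p \<le> z} z"
  have finF: "finite ?F" by (rule finite_sieve_family) simp
  have sub: "prime_factors n \<in> ?F" if n: "n \<in> {1..z}" for n
  proof -
    have "\<Prod>(prime_factors n) dvd n"
    proof -
      have "int (\<Prod>(prime_factors n)) dvd int n"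
        by (subst prod_primes_dvd_iff) auto
      then show ?thesis by (simp only: int_dvd_int_iff)
    qed
    then have "\<Prod>(prime_factors n) \<le> z" using n dvd_imp_le[of "\<Prod>(prime_factors n)" n] by auto
    moreover have "p \<le> z" if "p \<in> prime_factors n" for p
      using that n dvd_imp_le[of p n] by (auto simp: prime_factors_dvd)
    ultimately show ?thesis by (auto simp: sieve_family_def)
  qed
  have "ln (real z) \<le> ln (real z + 1)" using assms by simp
  also have "\<dots> \<le> harm z" by (rule ln_le_harm)
  also have "\<dots> = (\<Sum>n\<in>{1..z}. 1 / real n)" by (simp add: harm_def inverse_eq_divide)
  also have "\<dots> = (\<Sum>S\<in>?F. \<Sum>n | n \<in> {1..z} \<and> prime_factors n = S. 1 / real n)"
    using sub finF by (intro sum.group[symmetric]) auto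
  also have "\<dots> \<le> (\<Sum>S\<in>?F. 1 / phi_prod S)"
  proof (rule sum_mono)
    fix S assume "S \<in> ?F"
    then show "(\<Sum>n | n \<in> {1..z} \<and> prime_factors n = S. 1 / real n) \<le> 1 / phi_prod S"
      by (intro sum_inverse_same_prime_factors_le)
         (auto simp: sieve_family_def intro: finite_subset[of _ "{..z}"])
  qed
  finally show ?thesis by (simp add: selberg_sum_def)
qed

text \<open>Split each \<open>T\<close> into its part dividing \<open>k\<close> and the rest. The
  parts dividing \<open>k\<close> contribute at most the product of 1 + 1/(p - 1) over the primes p
  dividing \<open>k\<close>, which is k/phi(k).\<close>

lemma selberg_sum_coprime_ge:
  assumes "z \<ge> 1" "k > 0"
  shows "real (totient k) / real k * ln (real z) \<le> selberg_sum {p. prime p \<and> p \<le> z \<and> \<not> p dvd k} z"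
proof -
  define Q where "Q = {p. prime p \<and> p \<le> z}"
  define P where "P = {p. prime p \<and> p \<le> z \<and> \<not> p dvd k}"
  have fin: "finite Q" "finite P" by (auto simp: Q_def P_def)
  have pos: "phi_prod S > 0" if "S \<subseteq> Q \<or> S \<subseteq> prime_factors k" for S
    by (rule phi_prod_pos) (use that in \<open>auto simp: Q_def\<close>)
  have "selberg_sum Q z \<le> (\<Sum>(R, S)\<in>Pow (prime_factors k) \<times> sieve_family P z. 1 / phi_prod R * (1 / phi_prod S))"
    unfolding selberg_sum_def
  proof (rule sum_le_included[where i = "\<lambda>(R, S). R \<union> S"])
    show "\<forall>T\<in>sieve_family Q z. \<exists>RS\<in>Pow (prime_factors k) \<times> sieve_family P z.
      (case RS of (R, S) \<Rightarrow> R \<union> S) = T \<and>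
      1 / phi_prod T \<le> (case RS of (R, S) \<Rightarrow> 1 / phi_prod R * (1 / phi_prod S))"
    proof
      fix T assume T: "T \<in> sieve_family Q z"
      let ?R = "T \<inter> prime_factors k" and ?S = "T - prime_factors k"
      have TQ: "T \<subseteq> Q" "finite T" using T fin by (auto simp: sieve_family_def intro: finite_subset)
      have "?S \<in> sieve_family Q z"
        by (rule sieve_family_subset[OF fin(1) _ _ T]) (auto simp: Q_def)
      moreover have "?S \<subseteq> P" using TQ assms(2) by (auto simp: P_def Q_def prime_factors_dvd)
      ultimately have "?S \<in> sieve_family P z" by (simp add: sieve_family_def)
      moreover have "phi_prod T = phi_prod ?R * phi_prod ?S"
        unfolding phi_prod_def using TQ
        by (metis Int_Diff_disjoint Int_Diff_Un finite_Diff finite_Int prod.union_disjoint)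
      ultimately show "\<exists>RS\<in>Pow (prime_factors k) \<times> sieve_family P z.
        (case RS of (R, S) \<Rightarrow> R \<union> S) = T \<and>
        1 / phi_prod T \<le> (case RS of (R, S) \<Rightarrow> 1 / phi_prod R * (1 / phi_prod S))"
        by (intro bexI[of _ "(?R, ?S)"]) auto
    qed
    show "\<forall>RS\<in>Pow (prime_factors k) \<times> sieve_family P z.
      0 \<le> (case RS of (R, S) \<Rightarrow> 1 / phi_prod R * (1 / phi_prod S))"
    proof (rule ballI, clarify)
      fix R S assume "R \<subseteq> prime_factors k" "S \<in> sieve_family P z"
      then have "phi_prod R > 0" "phi_prod S > 0"
        by (auto intro!: pos simp: sieve_family_def P_def Q_def)
      then show "0 \<le> 1 / phi_prod R * (1 / phi_prod S)" by simp
    qed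
  qed (use fin finite_sieve_family in auto)
  also have "\<dots> = (\<Sum>R\<in>Pow (prime_factors k). 1 / phi_prod R) * selberg_sum P z"
    by (simp add: selberg_sum_def sum_product sum.cartesian_product)
  also have "(\<Sum>R\<in>Pow (prime_factors k). 1 / phi_prod R) = real k / real (totient k)"
  proof -
    have "(\<Sum>R\<in>Pow (prime_factors k). 1 / phi_prod R) = (\<Prod>p\<in>prime_factors k. 1 / (real p - 1) + 1)"
      by (subst prod_add) (auto simp: phi_prod_def prod_dividef)
    also have "\<dots> = (\<Prod>p\<in>prime_factors k. 1 / (1 - 1 / real p))"
    proof (rule prod.cong)
      fix p assume "p \<in> prime_factors k"
      then have "real p > 1" using prime_gt_1_nat[of p] by auto
      then show "1 / (real p - 1) + 1 = 1 / (1 - 1 / real p)" by (simp add: field_simps)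
    qed simp
    also have "\<dots> = real k / real (totient k)"
      using assms(2) by (simp add: totient_formula2 prod_dividef)
    finally show ?thesis .
  qed
  finally have "selberg_sum Q z \<le> real k / real (totient k) * selberg_sum P z" .
  with ln_le_selberg_sum_all_primes[OF assms(1)]
  have "ln (real z) \<le> real k / real (totient k) * selberg_sum P z" by (simp add: Q_def)
  then show ?thesis using assms(2) by (simp add: P_def field_simps)
qed

text \<open>The progression is sifted by the primes up to \<open>z\<close> not dividing
  \<open>k\<close>. Its density 1/k becomes 1/phi(k) through the factor phi(k)/k in the lower bound
  for G. The summand \<open>2 * z + 1\<close> counts the integers of absolute value at most
  \<open>z\<close>, where the sieve may remove primes.\<close>

theorem brun_titchmarsh:
  fixes N l :: int and k z :: nat
  assumes "N \<ge> 0" "z \<ge> 2" "k > 0" "coprime l (int k)"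
  shows "real (card {r\<in>{-N..N}. prime \<bar>r\<bar> \<and> [r = l] (mod int k)})
    \<le> (2 * real_of_int N + 1) / (real (totient k) * ln (real z)) + real z ^ 4 + 2 * real z + 1"
proof -
  define P where "P = {p. prime p \<and> p \<le> z \<and> \<not> p dvd k}"
  define A where "A = {m\<in>{-N..N}. [m = l] (mod int k)}"
  define X where "X = (2 * real_of_int N + 1) / real k"
  have finP: "finite P" and primeP: "\<And>p. p \<in> P \<Longrightarrow> prime p" by (auto simp: P_def)
  have finA: "finite A" unfolding A_def by (rule finite_subset[of _ "{-N..N}"]) auto
  have sieve: "real (card {m\<in>A. \<forall>p\<in>P. \<not> int p dvd m}) \<le> X / selberg_sum P z + real z ^ 4"
  proof (rule selberg_sieve[OF finP primeP])
    fix S assume S: "S \<subseteq> P"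
    have finS: "finite S" using S finP finite_subset by auto
    have "coprime (int k) (int (\<Prod>S))"
    proof -
      have "coprime k (\<Prod>S)"
      proof (rule prod_coprime_right)
        fix p assume "p \<in> S"
        then have "prime p" "\<not> p dvd k" using S by (auto simp: P_def)
        then show "coprime k p" by (metis coprime_commute prime_imp_coprime)
      qed
      then show ?thesis by (simp only: coprime_int_iff)
    qed
    \<comment> \<open>By the Chinese remainder theorem both conditions form a single class modulo
      \<open>k * \<Prod>S\<close>, so the counting error is at most 1.\<close>
    then obtain a where a: "[a = l] (mod int k)" "[a = 0] (mod int (\<Prod>S))"
      using binary_chinese_remainder_int by blast
    have "{m\<in>A. \<forall>p\<in>S. int p dvd m} = {m\<in>{-N..N}. [m = a] (mod (int k * int (\<Prod>S)))}"
    proof -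
      have "[m = a] (mod (int k * int (\<Prod>S))) \<longleftrightarrow> [m = l] (mod int k) \<and> (\<forall>p\<in>S. int p dvd m)" for m
      proof -
        have "[m = a] (mod (int k * int (\<Prod>S))) \<longleftrightarrow> [m = a] (mod int k) \<and> [m = a] (mod int (\<Prod>S))"
          using \<open>coprime (int k) (int (\<Prod>S))\<close>
          by (metis coprime_cong_mult cong_modulus_mult mult.commute)
        also have "[m = a] (mod int k) \<longleftrightarrow> [m = l] (mod int k)"
          using a by (metis cong_sym cong_trans)
        also have "[m = a] (mod int (\<Prod>S)) \<longleftrightarrow> [m = 0] (mod int (\<Prod>S))"
          using a by (metis cong_sym cong_trans)
        also have "\<dots> \<longleftrightarrow> (\<forall>p\<in>S. int p dvd m)"
          unfolding cong_0_iff using finS S primeP by (intro prod_primes_dvd_iff) auto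
        finally show ?thesis .
      qed
      then show ?thesis by (auto simp: A_def)
    qed
    moreover have pos: "\<Prod>S > 0" using S primeP prime_gt_0_nat by (intro prod_pos) auto
    have "int k * int (\<Prod>S) > 0" using assms(3) pos by (simp only: zero_less_mult_iff of_nat_0_less_iff) simp
    ultimately have "\<bar>real (card {m\<in>A. \<forall>p\<in>S. int p dvd m})
        - (2 * real_of_int N + 1) / real_of_int (int k * int (\<Prod>S))\<bar> \<le> 1"
      using card_residue_class_interval[OF assms(1)] by (simp only:)
    then show "\<bar>real (card {m\<in>A. \<forall>p\<in>S. int p dvd m}) - X / real (\<Prod>S)\<bar> \<le> 1"
      by (simp add: X_def)
  qed (use assms finA in auto)
  have lnz: "ln (real z) > 0" using assms by simp
  have tot: "real (totient k) > 0" using assms by simp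
  have G: "real (totient k) / real k * ln (real z) \<le> selberg_sum P z"
    unfolding P_def using assms by (intro selberg_sum_coprime_ge) auto
  have "X / selberg_sum P z \<le> X / (real (totient k) / real k * ln (real z))"
    using G lnz tot assms selberg_sum_pos[OF finP primeP, of z]
    by (intro divide_left_mono mult_pos_pos) (auto simp: X_def)
  also have "\<dots> = (2 * real_of_int N + 1) / (real (totient k) * ln (real z))"
    using assms by (simp add: X_def)
  finally have main: "X / selberg_sum P z \<le> (2 * real_of_int N + 1) / (real (totient k) * ln (real z))" .
  have "{r\<in>{-N..N}. prime \<bar>r\<bar> \<and> [r = l] (mod int k)}
      \<subseteq> {m\<in>A. \<forall>p\<in>P. \<not> int p dvd m} \<union> {- int z..int z}"
  proof
    fix r assume r: "r \<in> {r\<in>{-N..N}. prime \<bar>r\<bar> \<and> [r = l] (mod int k)}"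
    show "r \<in> {m\<in>A. \<forall>p\<in>P. \<not> int p dvd m} \<union> {- int z..int z}"
    proof (rule ccontr)
      assume "\<not> ?thesis"
      then obtain p where p: "p \<in> P" "int p dvd r" "\<bar>r\<bar> > int z" using r by (auto simp: A_def)
      then have "prime (int p)" "int p dvd \<bar>r\<bar>" by (auto simp: P_def)
      then have "int p = \<bar>r\<bar>" using r primes_dvd_imp_eq by blast
      then show False using p by (auto simp: P_def)
    qed
  qed
  then have "card {r\<in>{-N..N}. prime \<bar>r\<bar> \<and> [r = l] (mod int k)}
      \<le> card ({m\<in>A. \<forall>p\<in>P. \<not> int p dvd m} \<union> {- int z..int z})"
    using finA by (intro card_mono) auto
  also have "\<dots> \<le> card {m\<in>A. \<forall>p\<in>P. \<not> int p dvd m} + card {- int z..int z}"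
    by (rule card_Un_le)
  finally have "real (card {r\<in>{-N..N}. prime \<bar>r\<bar> \<and> [r = l] (mod int k)})
      \<le> real (card {m\<in>A. \<forall>p\<in>P. \<not> int p dvd m}) + (2 * real z + 1)" by simp
  with sieve main show ?thesis by linarith
qed

section \<open>Point probabilities\<close>

lemma (in prob_space) char_gaussian_bound_near_0:
  fixes X :: "'a \<Rightarrow> real"
  assumes X: "random_variable borel X" "integrable M X" "integrable M (\<lambda>x. (X x)\<^sup>2)"
    "integrable M (\<lambda>x. \<bar>X x\<bar> ^ 3)" "expectation X = 0" "expectation (\<lambda>x. (X x)\<^sup>2) = 1"
  shows "\<exists>\<delta>>0. \<forall>t. \<bar>t\<bar> \<le> \<delta> \<longrightarrow> cmod (char (distr M borel X) t) \<le> exp (- (t\<^sup>2 / 4))"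
proof -
  note [measurable] = X(1)
  define \<rho> where "\<rho> = expectation (\<lambda>x. \<bar>X x\<bar> ^ 3)"
  have "\<rho> \<ge> 0" unfolding \<rho>_def by (intro integral_nonneg_AE) auto
  \<comment> \<open>For \<open>\<bar>t\<bar> \<le> \<delta>\<close> the Taylor error \<rho> |t|^3 /
    6 is at most t^2/6, and 1 - t^2/2 is nonnegative. This leaves 1 - t^2/3, which is below 1 -
    t^2/4.\<close>
  define \<delta> where "\<delta> = 1 / (\<rho> + 1)"
  have \<delta>: "\<delta> > 0" "\<delta> \<le> 1" "\<delta> * \<rho> \<le> 1" using \<open>\<rho> \<ge> 0\<close> by (auto simp: \<delta>_def field_simps)
  have "cmod (char (distr M borel X) t) \<le> exp (- (t\<^sup>2 / 4))" if t: "\<bar>t\<bar> \<le> \<delta>" for t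
  proof -
    have "t\<^sup>2 \<le> 1" using t \<delta> by (simp add: abs_square_le_1)
    have "expectation (\<lambda>x. min (6 * (X x)\<^sup>2) (\<bar>t\<bar> * \<bar>X x\<bar> ^ 3)) \<le> expectation (\<lambda>x. \<bar>t\<bar> * \<bar>X x\<bar> ^ 3)"
      using X by (intro integral_mono Bochner_Integration.integrable_bound
        [OF integrable_mult_right[OF X(4), of "\<bar>t\<bar>"], of "\<lambda>x. min (6 * (X x)\<^sup>2) (\<bar>t\<bar> * \<bar>X x\<bar> ^ 3)"]) auto
    also have "\<dots> = \<bar>t\<bar> * \<rho>" by (simp add: \<rho>_def)
    also have "\<dots> \<le> \<delta> * \<rho>" using t \<open>\<rho> \<ge> 0\<close> by (intro mult_right_mono)
    also have "\<dots> \<le> 1" by fact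
    finally have "t\<^sup>2 / 6 * expectation (\<lambda>x. min (6 * (X x)\<^sup>2) (\<bar>t\<bar> * \<bar>X x\<bar> ^ 3)) \<le> t\<^sup>2 / 6 * 1"
      by (intro mult_left_mono) auto
    moreover have "cmod (char (distr M borel X) t - (1 - t\<^sup>2 * 1 / 2))
        \<le> t\<^sup>2 / 6 * expectation (\<lambda>x. min (6 * (X x)\<^sup>2) (\<bar>t\<bar> * \<bar>X x\<bar> ^ 3))"
      by (rule order_trans[OF _ char_approx3'[OF X(1-3,5) _ refl]]) (use X in auto)
    ultimately have "cmod (char (distr M borel X) t - complex_of_real (1 - t\<^sup>2 / 2)) \<le> t\<^sup>2 / 6"
      by simp
    then have "cmod (char (distr M borel X) t) \<le> cmod (complex_of_real (1 - t\<^sup>2 / 2)) + t\<^sup>2 / 6"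
      using norm_triangle_sub[of "char (distr M borel X) t" "complex_of_real (1 - t\<^sup>2 / 2)"] by linarith
    also have "cmod (complex_of_real (1 - t\<^sup>2 / 2)) = 1 - t\<^sup>2 / 2"
      using \<open>t\<^sup>2 \<le> 1\<close> unfolding norm_of_real by simp
    also have "1 - t\<^sup>2 / 2 + t\<^sup>2 / 6 \<le> 1 + - (t\<^sup>2 / 4)" by simp
    also have "\<dots> \<le> exp (- (t\<^sup>2 / 4))" by (rule exp_ge_add_one_self)
    finally show ?thesis .
  qed
  with \<delta>(1) show ?thesis by blast
qed

lemma cis_kernel_square:
  "complex_of_real ((cmod (\<Sum>j<J. cis (real j * u)))\<^sup>2)
     = (\<Sum>i<J. \<Sum>j<J. cis ((real i - real j) * u))"
  unfolding complex_norm_square cnj_sum sum_product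
  by (intro sum.cong refl) (simp add: cis_cnj cis_mult left_diff_distrib)

text \<open>The Fejer kernel evaluated at \<open>S - y\<close> equals \<open>J\<^sup>2\<close> on the event \<open>S = y\<close>.\<close>

lemma (in prob_space) point_prob_le_char_sum:
  fixes S :: "'a \<Rightarrow> real"
  assumes [measurable]: "random_variable borel S"
  shows "prob {\<omega> \<in> space M. S \<omega> = y} * (real J)\<^sup>2
    \<le> (\<Sum>i<J. \<Sum>j<J. cmod (char (distr M borel S) ((real i - real j) * h)))"
proof -
  define K where "K = (\<lambda>\<omega>. (cmod (\<Sum>j<J. cis (real j * (h * (S \<omega> - y)))))\<^sup>2)"
  have [measurable]: "(\<lambda>\<omega>. cis (a * (h * (S \<omega> - y)))) \<in> borel_measurable M" for a
    unfolding cis_conv_exp by measurable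
  have int: "integrable M (\<lambda>\<omega>. cis (a * (h * (S \<omega> - y))))" for a
    by (rule integrable_const_bound[of _ 1]) auto
  have K_eq: "complex_of_real (K \<omega>) = (\<Sum>i<J. \<Sum>j<J. cis ((real i - real j) * (h * (S \<omega> - y))))" for \<omega>
    unfolding K_def by (rule cis_kernel_square)
  have "integrable M (\<lambda>\<omega>. complex_of_real (K \<omega>))"
    unfolding K_eq by (intro Bochner_Integration.integrable_sum int)
  then have intK: "integrable M K" using integrable_Re by fastforce
  \<comment> \<open>The shift by \<open>y\<close> only contributes a factor of modulus 1, which is
    why the final bound is uniform in \<open>y\<close>.\<close>
  have term_le: "cmod (\<integral>\<omega>. cis (a * (h * (S \<omega> - y))) \<partial>M) \<le> cmod (char (distr M borel S) (a * h))" for a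
  proof -
    have "(\<integral>\<omega>. cis (a * (h * (S \<omega> - y))) \<partial>M) = (\<integral>\<omega>. cis (- (a * h * y)) * iexp (a * h * S \<omega>) \<partial>M)"
      unfolding cis_conv_exp[symmetric] cis_mult
      by (intro Bochner_Integration.integral_cong refl) (simp add: algebra_simps)
    also have "\<dots> = cis (- (a * h * y)) * (\<integral>\<omega>. iexp (a * h * S \<omega>) \<partial>M)"
      by (rule integral_mult_right_zero)
    also have "(\<integral>\<omega>. iexp (a * h * S \<omega>) \<partial>M) = char (distr M borel S) (a * h)"
      unfolding char_def by (subst integral_distr) auto
    finally show ?thesis by (simp add: norm_mult)
  qed
  have "prob {\<omega> \<in> space M. S \<omega> = y} * (real J)\<^sup>2
      = expectation (\<lambda>\<omega>. indicator {\<omega> \<in> space M. S \<omega> = y} \<omega> * (real J)\<^sup>2)"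
    by simp
  also have "\<dots> \<le> expectation K"
  proof (intro integral_mono intK)
    show "indicator {\<omega> \<in> space M. S \<omega> = y} \<omega> * (real J)\<^sup>2 \<le> K \<omega>" if "\<omega> \<in> space M" for \<omega>
      by (cases "S \<omega> = y") (auto simp: K_def that)
    show "integrable M (\<lambda>\<omega>. indicator {\<omega> \<in> space M. S \<omega> = y} \<omega> * (real J)\<^sup>2)"
      by (intro integrable_mult_left integrable_real_indicator) (auto simp: less_top[symmetric])
  qed
  also have "\<dots> \<le> cmod (complex_of_real (expectation K))" by simp
  also have "complex_of_real (expectation K) = (\<integral>\<omega>. complex_of_real (K \<omega>) \<partial>M)" by simp
  also have "\<dots> = (\<Sum>i<J. \<Sum>j<J. \<integral>\<omega>. cis ((real i - real j) * (h * (S \<omega> - y))) \<partial>M)"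
    unfolding K_eq by (simp add: Bochner_Integration.integral_sum int)
  also have "cmod \<dots> \<le> (\<Sum>i<J. \<Sum>j<J. cmod (char (distr M borel S) ((real i - real j) * h)))"
    by (intro order_trans[OF norm_sum] sum_mono term_le)
  finally show ?thesis .
qed

text \<open>Each side of the diagonal is part of a geometric series. Row sums bounded independently
  of \<open>J\<close> make the double sum over i and j of order \<open>J\<close> rather than
  \<open>J\<^sup>2\<close>.\<close>

lemma sum_geometric_abs_le:
  fixes q :: real
  assumes "0 \<le> q" "q < 1"
  shows "(\<Sum>j<J. q ^ nat \<bar>int i - int j\<bar>) \<le> 2 / (1 - q)"
proof -
  have geo: "(\<Sum>m\<in>A. q ^ m) \<le> 1 / (1 - q)" if "finite A" for A :: "nat set"
    using sum_le_suminf[of "\<lambda>m. q ^ m" A] assms that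
    by (simp add: suminf_geometric summable_geometric)
  have "(\<Sum>j<J. q ^ nat \<bar>int i - int j\<bar>)
      = (\<Sum>j\<in>{..<J} \<inter> {..i}. q ^ nat \<bar>int i - int j\<bar>) + (\<Sum>j\<in>{..<J} - {..i}. q ^ nat \<bar>int i - int j\<bar>)"
    by (rule sum.Int_Diff) simp
  also have "(\<Sum>j\<in>{..<J} \<inter> {..i}. q ^ nat \<bar>int i - int j\<bar>) = (\<Sum>m\<in>(\<lambda>j. i - j) ` ({..<J} \<inter> {..i}). q ^ m)"
    by (subst sum.reindex) (auto simp: inj_on_def nat_diff_distrib' intro!: sum.cong arg_cong[where f = "(^) q"])
  also have "\<dots> \<le> 1 / (1 - q)" by (rule geo) simp
  also have "(\<Sum>j\<in>{..<J} - {..i}. q ^ nat \<bar>int i - int j\<bar>) = (\<Sum>m\<in>(\<lambda>j. j - i) ` ({..<J} - {..i}). q ^ m)"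
    by (subst sum.reindex) (auto simp: inj_on_def intro!: sum.cong arg_cong[where f = "(^) q"])
  also have "\<dots> \<le> 1 / (1 - q)" by (rule geo) simp
  finally show ?thesis by simp
qed

text \<open>With spacing 1/sqrt n and \<open>J\<close> about \<delta> sqrt n, all frequencies (i -
  j)/sqrt n lie in [-\<delta>, \<delta>]. There the n-th power of the characteristic function is at
  most exp (-(i - j)^2 / 4), so the kernel sum is of order \<open>J\<close>, and division by
  \<open>J\<^sup>2\<close> leaves order 1/sqrt n.\<close>

theorem (in prob_space) point_prob_iid_sum_le:
  fixes X :: "'a \<Rightarrow> real" and Xs :: "nat \<Rightarrow> 'a \<Rightarrow> real"
  assumes X: "random_variable borel X" "integrable M X" "integrable M (\<lambda>x. (X x)\<^sup>2)"
    "integrable M (\<lambda>x. \<bar>X x\<bar> ^ 3)" "expectation X = 0" "expectation (\<lambda>x. (X x)\<^sup>2) = 1"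
    and indep: "indep_vars (\<lambda>_. borel) Xs {1..}"
    and iid: "\<And>i. i \<ge> 1 \<Longrightarrow> distr M borel (Xs i) = distr M borel X"
  shows "\<exists>C>0. \<forall>\<^sub>F n in sequentially. \<forall>y.
    prob {\<omega> \<in> space M. (\<Sum>i=1..n. Xs i \<omega>) = y} \<le> C / sqrt (real n)"
proof -
  obtain \<delta> where \<delta>: "\<delta> > 0"
    and char_le: "\<And>t. \<bar>t\<bar> \<le> \<delta> \<Longrightarrow> cmod (char (distr M borel X) t) \<le> exp (- (t\<^sup>2 / 4))"
    using char_gaussian_bound_near_0[OF X] by blast
  define q where "q = exp (- (1 / 4 :: real))"
  define Q where "Q = 2 / (1 - q)"
  have q: "0 < q" "q < 1" by (auto simp: q_def)
  then have Q: "Q > 0" by (simp add: Q_def)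
  have bound: "prob {\<omega> \<in> space M. (\<Sum>i=1..n. Xs i \<omega>) = y} \<le> (2 * Q / \<delta>) / sqrt (real n)"
    if n: "n > 0" "\<delta> * sqrt (real n) \<ge> 2" for n y
  proof -
    define S where "S = (\<lambda>\<omega>. \<Sum>i=1..n. Xs i \<omega>)"
    define J where "J = nat \<lfloor>\<delta> * sqrt (real n)\<rfloor>"
    define h where "h = 1 / sqrt (real n)"
    \<comment> \<open>Taking the floor of a number that is at least 2 loses at most half of
      it.\<close>
    have J: "real J \<le> \<delta> * sqrt (real n)" "real J \<ge> \<delta> * sqrt (real n) / 2" "real J > 0"
      using n(2) unfolding J_def by linarith+
    have indep_n: "indep_vars (\<lambda>_. borel) Xs {1..n}"
      using indep by (rule indep_vars_subset) auto
    then have [measurable]: "random_variable borel S"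
      unfolding S_def by (intro borel_measurable_sum) (auto simp: indep_vars_def)
    have char_S: "char (distr M borel S) t = char (distr M borel X) t ^ n" for t
      unfolding S_def using char_distr_sum[OF indep_n, of t] iid by simp
    have term_le: "cmod (char (distr M borel S) ((real i - real j) * h)) \<le> q ^ nat \<bar>int i - int j\<bar>"
      if "i < J" "j < J" for i j
    proof -
      define m where "m = nat \<bar>int i - int j\<bar>"
      have m: "\<bar>real i - real j\<bar> = real m" by (simp add: m_def)
      define t where "t = (real i - real j) * h"
      have "\<bar>t\<bar> = real m * h" by (simp add: t_def abs_mult m h_def)
      moreover have "m \<le> J" using that by (simp add: m_def)
      then have "real m * h \<le> \<delta> * sqrt (real n) * h"
        using J by (intro mult_right_mono) (auto simp: h_def)
      ultimately have "\<bar>t\<bar> \<le> \<delta>" using n by (simp add: h_def)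
      have "t\<^sup>2 * real n = (real m)\<^sup>2"
      proof -
        have "t\<^sup>2 = (real m)\<^sup>2 * h\<^sup>2" using \<open>\<bar>t\<bar> = real m * h\<close> by (metis power2_abs power_mult_distrib)
        then show ?thesis using n by (simp add: h_def power_divide)
      qed
      have "cmod (char (distr M borel S) t) \<le> exp (- (t\<^sup>2 / 4)) ^ n"
        unfolding char_S norm_power using char_le[OF \<open>\<bar>t\<bar> \<le> \<delta>\<close>] by (intro power_mono) auto
      also have "\<dots> = exp (- (t\<^sup>2 * real n / 4))"
        by (simp add: exp_of_nat_mult[symmetric] mult.commute)
      also have "\<dots> = exp (- ((real m)\<^sup>2 / 4))" using \<open>t\<^sup>2 * real n = (real m)\<^sup>2\<close> by simp
      \<comment> \<open>Gaussian decay is weakened to geometric decay, which can be summed exactly;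
        \<open>m \<le> m ^ 2\<close> covers \<open>m = 0\<close> as well.\<close>
      also have "\<dots> \<le> exp (real m * (- (1 / 4)))"
      proof -
        have "m \<le> m ^ 2" by (simp add: power2_eq_square)
        then have "real m \<le> (real m)\<^sup>2" by (metis of_nat_le_iff of_nat_power)
        then show ?thesis by simp
      qed
      also have "\<dots> = q ^ m" unfolding q_def by (rule exp_of_nat_mult)
      finally show ?thesis by (simp add: t_def m_def)
    qed
    have "prob {\<omega> \<in> space M. S \<omega> = y} * (real J)\<^sup>2
        \<le> (\<Sum>i<J. \<Sum>j<J. cmod (char (distr M borel S) ((real i - real j) * h)))"
      by (rule point_prob_le_char_sum) simp
    also have "\<dots> \<le> (\<Sum>i<J. \<Sum>j<J. q ^ nat \<bar>int i - int j\<bar>)"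
      by (intro sum_mono term_le) auto
    also have "\<dots> \<le> (\<Sum>i<J. Q)"
      unfolding Q_def using q by (intro sum_mono sum_geometric_abs_le) auto
    also have "\<dots> = real J * Q" by simp
    finally have "prob {\<omega> \<in> space M. S \<omega> = y} * real J \<le> Q"
      using J(3) by (simp add: power2_eq_square mult.assoc[symmetric] mult.commute[of "real J" Q])
    then have "prob {\<omega> \<in> space M. S \<omega> = y} \<le> Q / real J"
      using J(3) by (simp add: pos_le_divide_eq)
    also have "\<dots> \<le> Q / (\<delta> * sqrt (real n) / 2)"
      using J Q n by (intro divide_left_mono mult_pos_pos) auto
    finally show ?thesis by (simp add: S_def mult.commute)
  qed
  have "\<forall>\<^sub>F n in sequentially. \<delta> * sqrt (real n) \<ge> 2"
    using \<delta> by real_asymp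
  then have "\<forall>\<^sub>F n in sequentially. \<forall>y.
    prob {\<omega> \<in> space M. (\<Sum>i=1..n. Xs i \<omega>) = y} \<le> (2 * Q / \<delta>) / sqrt (real n)"
    using eventually_gt_at_top[of 0] by eventually_elim (use bound in auto)
  moreover have "2 * Q / \<delta> > 0" using Q \<delta> by simp
  ultimately show ?thesis by blast
qed

section \<open>Tail bound\<close>

lemma exp_le_quadratic:
  fixes v :: real
  assumes "\<bar>v\<bar> \<le> 1"
  shows "exp v \<le> 1 + v + v\<^sup>2"
proof (cases "v \<ge> 0")
  case True
  then show ?thesis using assms by (intro exp_bound) auto
next
  case False
  define w where "w = - v"
  have w: "w \<ge> 0" using False by (simp add: w_def)
  \<comment> \<open>The product equals 1 + w^4/4, so the first factor dominates exp (-w).\<close>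
  have "1 \<le> (1 - w + w\<^sup>2 / 2) * (1 + w + w\<^sup>2 / 2)"
    by (simp add: power2_eq_square algebra_simps) (use w in simp)
  also have "\<dots> \<le> (1 - w + w\<^sup>2 / 2) * exp w"
  proof (rule mult_left_mono)
    show "1 + w + w\<^sup>2 / 2 \<le> exp w" using w by (rule exp_lower_Taylor_quadratic)
    have "0 \<le> (1 - w)\<^sup>2 + 1" by simp
    then show "0 \<le> 1 - w + w\<^sup>2 / 2" by (simp add: power2_eq_square algebra_simps)
  qed
  finally have "exp v \<le> 1 - w + w\<^sup>2 / 2" by (simp add: w_def exp_minus field_simps)
  also have "\<dots> \<le> 1 + v + v\<^sup>2" by (simp add: w_def)
  finally show ?thesis .
qed

text \<open>Reflection shows that the integral equals its own negative, also when it has the default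
  value 0. Applied to the odd function \<open>cutoff\<close>, this says that cutting off does not
  move the mean.\<close>

lemma symmetric_rv_odd_integral:
  fixes f :: "real \<Rightarrow> real"
  assumes "symmetric_rv M X" "f \<in> borel_measurable borel" "\<And>u. f (- u) = - f u"
  shows "(\<integral>\<omega>. f (X \<omega>) \<partial>M) = 0"
proof -
  have [measurable]: "X \<in> borel_measurable M" "f \<in> borel_measurable borel"
    using assms by (auto simp: symmetric_rv_def)
  have "(\<integral>\<omega>. f (X \<omega>) \<partial>M) = (\<integral>u. f u \<partial>distr M borel X)" by (simp add: integral_distr)
  also have "distr M borel X = distr M borel (\<lambda>\<omega>. - X \<omega>)"
    using assms(1) by (simp add: symmetric_rv_def)
  also have "(\<integral>u. f u \<partial>distr M borel (\<lambda>\<omega>. - X \<omega>)) = (\<integral>\<omega>. f (- X \<omega>) \<partial>M)"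
    by (simp add: integral_distr)
  also have "\<dots> = - (\<integral>\<omega>. f (X \<omega>) \<partial>M)" by (simp add: assms(3))
  finally show ?thesis by simp
qed

definition cutoff :: "real \<Rightarrow> real \<Rightarrow> real" where
  "cutoff \<tau> u = (if \<bar>u\<bar> \<le> \<tau> then u else 0)"

lemma cutoff_measurable [measurable]: "cutoff \<tau> \<in> borel_measurable borel"
  unfolding cutoff_def [abs_def] by measurable

text \<open>The bound on \<open>\<bar>s\<bar> * \<tau>\<close> keeps the exponent where exp is below
  its quadratic majorant. The linear term then vanishes by symmetry, and cutting off can only lower
  the second moment.\<close>

lemma (in prob_space) cutoffd_mgf_le:
  assumes sym: "symmetric_rv M X" and int: "integrable M (\<lambda>x. (X x)\<^sup>2)"
    and var: "expectation (\<lambda>x. (X x)\<^sup>2) \<le> 1" and s: "\<bar>s\<bar> * \<tau> \<le> 1" "\<tau> \<ge> 0"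
  shows "expectation (\<lambda>\<omega>. exp (s * cutoff \<tau> (X \<omega>))) \<le> exp (s\<^sup>2)"
proof -
  have [measurable]: "random_variable borel X" using sym by (simp add: symmetric_rv_def)
  define Y where "Y = (\<lambda>\<omega>. cutoff \<tau> (X \<omega>))"
  have [measurable]: "random_variable borel Y" unfolding Y_def by measurable
  have Y_le: "\<bar>Y \<omega>\<bar> \<le> \<tau>" for \<omega> using s(2) by (simp add: Y_def cutoff_def)
  have sY_le: "\<bar>s * Y \<omega>\<bar> \<le> 1" for \<omega>
    using mult_left_mono[OF Y_le[of \<omega>], of "\<bar>s\<bar>"] s(1) by (simp add: abs_mult)
  have intY: "integrable M Y" by (rule integrable_const_bound[of _ \<tau>]) (use Y_le in auto)
  have "Y \<omega> ^ 2 \<le> X \<omega> ^ 2" for \<omega> by (simp add: Y_def cutoff_def)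
  then have intY2: "integrable M (\<lambda>\<omega>. (Y \<omega>)\<^sup>2)" and "expectation (\<lambda>\<omega>. (Y \<omega>)\<^sup>2) \<le> expectation (\<lambda>x. (X x)\<^sup>2)"
    by (auto intro!: integral_mono int Bochner_Integration.integrable_bound[OF int])
  have "expectation Y = 0"
    unfolding Y_def by (rule symmetric_rv_odd_integral[OF sym]) (auto simp: cutoff_def)
  have "expectation (\<lambda>\<omega>. exp (s * Y \<omega>)) \<le> expectation (\<lambda>\<omega>. 1 + s * Y \<omega> + s\<^sup>2 * (Y \<omega>)\<^sup>2)"
  proof (rule integral_mono)
    show "integrable M (\<lambda>\<omega>. exp (s * Y \<omega>))"
      by (rule integrable_const_bound[of _ "exp 1"]) (use sY_le in \<open>auto simp: abs_le_iff\<close>)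
    show "exp (s * Y \<omega>) \<le> 1 + s * Y \<omega> + s\<^sup>2 * (Y \<omega>)\<^sup>2" for \<omega>
      using exp_le_quadratic[OF sY_le[of \<omega>]] by (simp add: power_mult_distrib)
  qed (use intY intY2 in auto)
  also have "\<dots> = 1 + s\<^sup>2 * expectation (\<lambda>\<omega>. (Y \<omega>)\<^sup>2)"
    using intY intY2 \<open>expectation Y = 0\<close> by (simp add: prob_space)
  also have "\<dots> \<le> 1 + s\<^sup>2 * 1"
    using \<open>expectation (\<lambda>\<omega>. (Y \<omega>)\<^sup>2) \<le> _\<close> var by (intro add_left_mono mult_left_mono) auto
  also have "\<dots> \<le> exp (s\<^sup>2)" by simp
  finally show ?thesis by (simp add: Y_def)
qed

lemma integral_cong_distr:
  fixes f :: "real \<Rightarrow> real"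
  assumes "distr M borel Y = distr M borel X" "X \<in> borel_measurable M" "Y \<in> borel_measurable M"
    "f \<in> borel_measurable borel"
  shows "(\<integral>\<omega>. f (Y \<omega>) \<partial>M) = (\<integral>\<omega>. f (X \<omega>) \<partial>M)"
  using integral_distr[OF assms(3,4)] integral_distr[OF assms(2,4)] assms(1) by simp

lemma (in prob_space) cutoffd_sum_tail:
  assumes sym: "symmetric_rv M X" and int: "integrable M (\<lambda>x. (X x)\<^sup>2)"
    and var: "expectation (\<lambda>x. (X x)\<^sup>2) \<le> 1"
    and indep: "indep_vars (\<lambda>_. borel) Xs {1..n}"
    and iid: "\<And>i. i \<in> {1..n} \<Longrightarrow> distr M borel (Xs i) = distr M borel X"
    and n: "n > 0" and x: "x > 0" and \<sigma>: "\<bar>\<sigma>\<bar> = 1"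
  shows "prob {\<omega> \<in> space M. (\<Sum>i=1..n. \<sigma> * cutoff (2 * real n / x) (Xs i \<omega>)) \<ge> x}
    \<le> exp (- (x\<^sup>2 / (4 * real n)))"
proof -
  define \<tau> where "\<tau> = 2 * real n / x"
  \<comment> \<open>This \<open>t\<close> minimises n t^2 - t x, with minimum -x^2/(4n). The height
    \<open>\<tau>\<close> is 1/t, the largest one that the moment bound allows. The sign
    \<open>\<sigma>\<close> lets one argument serve both tails.\<close>
  define t where "t = x / (2 * real n)"
  have t: "t > 0" "\<tau> \<ge> 0" "\<bar>t * \<sigma>\<bar> * \<tau> \<le> 1" using n x \<sigma> by (auto simp: t_def \<tau>_def abs_mult)
  have [measurable]: "random_variable borel X" using sym by (simp add: symmetric_rv_def)
  have rv: "random_variable borel (Xs i)" if "i \<in> {1..n}" for i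
    using indep that by (auto simp: indep_vars_def)
  define E where "E = (\<lambda>i \<omega>. exp (t * \<sigma> * cutoff \<tau> (Xs i \<omega>)))"
  have indepE: "indep_vars (\<lambda>_. borel) E {1..n}"
    unfolding E_def by (rule indep_vars_compose2[OF indep]) measurable
  have intE: "integrable M (E i)" if "i \<in> {1..n}" for i
  proof (rule integrable_const_bound[of _ "exp 1"])
    have "\<bar>cutoff \<tau> u\<bar> \<le> \<tau>" for u using t by (simp add: cutoff_def)
    then have "\<bar>t * \<sigma> * cutoff \<tau> u\<bar> \<le> 1" for u
      using mult_left_mono[of "\<bar>cutoff \<tau> u\<bar>" \<tau> "\<bar>t * \<sigma>\<bar>"] t(3) by (simp add: abs_mult[of "t * \<sigma>"])
    then show "AE \<omega> in M. norm (E i \<omega>) \<le> exp 1" by (auto simp: E_def abs_le_iff)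
    show "random_variable borel (E i)" using indepE that by (auto simp: indep_vars_def)
  qed
  have prod_eq: "exp (1 * (t * (\<Sum>i=1..n. \<sigma> * cutoff \<tau> (Xs i \<omega>)))) = (\<Prod>i\<in>{1..n}. E i \<omega>)" for \<omega>
    by (simp add: E_def sum_distrib_left exp_sum mult.assoc)
  have int_prod: "integrable M (\<lambda>\<omega>. \<Prod>i\<in>{1..n}. E i \<omega>)"
    by (rule indep_vars_integrable[OF _ indepE]) (auto intro: intE)
  have "prob {\<omega> \<in> space M. (\<Sum>i=1..n. \<sigma> * cutoff \<tau> (Xs i \<omega>)) \<ge> x}
      = prob {\<omega> \<in> space M. t * (\<Sum>i=1..n. \<sigma> * cutoff \<tau> (Xs i \<omega>)) \<ge> t * x}"
    using t(1) by simp
  \<comment> \<open>The parameter \<open>t\<close> is already absorbed into the random variable, so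
    the Chernoff bound is used with parameter 1.\<close>
  also have "\<dots> \<le> exp (- 1 * (t * x)) *
      (\<integral>\<omega>\<in>space M. exp (1 * (t * (\<Sum>i=1..n. \<sigma> * cutoff \<tau> (Xs i \<omega>)))) \<partial>M)"
  proof (rule Chernoff_ineq_ge)
    show "set_integrable M (space M) (\<lambda>\<omega>. exp (1 * (t * (\<Sum>i=1..n. \<sigma> * cutoff \<tau> (Xs i \<omega>)))))"
      unfolding prod_eq set_integrable_def using int_prod by (rule integrable_mult_indicator[rotated]) simp
  qed auto
  also have "(\<integral>\<omega>\<in>space M. exp (1 * (t * (\<Sum>i=1..n. \<sigma> * cutoff \<tau> (Xs i \<omega>)))) \<partial>M)
      = (\<integral>\<omega>. (\<Prod>i\<in>{1..n}. E i \<omega>) \<partial>M)"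
    unfolding prod_eq using int_prod by (rule set_integral_space)
  also have "\<dots> = (\<Prod>i\<in>{1..n}. expectation (E i))"
    by (rule indep_vars_lebesgue_integral[OF _ indepE]) (auto intro: intE)
  also have "\<dots> \<le> (\<Prod>i\<in>{1..n}. exp (t\<^sup>2))"
  proof (intro prod_mono conjI)
    fix i assume i: "i \<in> {1..n}"
    show "expectation (E i) \<ge> 0" by (intro integral_nonneg_AE) (auto simp: E_def)
    have "expectation (E i) = expectation (\<lambda>\<omega>. exp (t * \<sigma> * cutoff \<tau> (X \<omega>)))"
      unfolding E_def using iid[OF i] rv[OF i]
      by (intro integral_cong_distr[where f = "\<lambda>u. exp (t * \<sigma> * cutoff \<tau> u)"]) auto
    also have "\<dots> \<le> exp ((t * \<sigma>)\<^sup>2)" by (rule cutoffd_mgf_le[OF sym int var t(3,2)])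
    also have "(t * \<sigma>)\<^sup>2 = t\<^sup>2" using \<sigma> by (simp add: power_mult_distrib abs_square_eq_1)
    finally show "expectation (E i) \<le> exp (t\<^sup>2)" .
  qed
  also have "\<dots> = exp (real n * t\<^sup>2)" by (simp add: exp_of_nat_mult)
  also have "exp (- 1 * (t * x)) * exp (real n * t\<^sup>2) = exp (- (x\<^sup>2 / (4 * real n)))"
    unfolding exp_add[symmetric] using n by (simp add: t_def field_simps power2_eq_square)
  finally show ?thesis by (simp add: \<tau>_def)
qed

text \<open>If every summand is below \<tau> = 2n/x in absolute value, the sum coincides with its
  cut-off version. Otherwise some summand is large; by Markov's inequality for the third power this
  has probability at most n \<rho> / \<tau>^3, the last term of the bound.\<close>

theorem (in prob_space) symmetric_sum_tail:
  assumes sym: "symmetric_rv M X" and int: "integrable M (\<lambda>x. (X x)\<^sup>2)"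
    and var: "expectation (\<lambda>x. (X x)\<^sup>2) \<le> 1" and int3: "integrable M (\<lambda>x. \<bar>X x\<bar> ^ 3)"
    and indep: "indep_vars (\<lambda>_. borel) Xs {1..n}"
    and iid: "\<And>i. i \<in> {1..n} \<Longrightarrow> distr M borel (Xs i) = distr M borel X"
    and n: "n > 0" and x: "x > 0"
  shows "prob {\<omega> \<in> space M. \<bar>\<Sum>i=1..n. Xs i \<omega>\<bar> \<ge> x}
    \<le> 2 * exp (- (x\<^sup>2 / (4 * real n))) + expectation (\<lambda>x. \<bar>X x\<bar> ^ 3) * x ^ 3 / (8 * (real n)\<^sup>2)"
proof -
  define \<tau> where "\<tau> = 2 * real n / x"
  have \<tau>: "\<tau> > 0" using n x by (simp add: \<tau>_def)
  define T where "T = (\<lambda>\<sigma>. {\<omega> \<in> space M. (\<Sum>i=1..n. \<sigma> * cutoff \<tau> (Xs i \<omega>)) \<ge> x})"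
  define L where "L = (\<lambda>i. {\<omega> \<in> space M. \<bar>Xs i \<omega>\<bar> \<ge> \<tau>})"
  define \<rho> where "\<rho> = expectation (\<lambda>x. \<bar>X x\<bar> ^ 3)"
  have [measurable]: "random_variable borel X" using sym by (simp add: symmetric_rv_def)
  have rv [measurable]: "random_variable borel (Xs i)" if "i \<in> {1..n}" for i
    using indep that by (auto simp: indep_vars_def)
  have T_sets: "T \<sigma> \<in> events" for \<sigma> unfolding T_def by measurable
  have L_sets: "L i \<in> events" if "i \<in> {1..n}" for i
    unfolding L_def using rv[OF that] by measurable
  have L_le: "prob (L i) \<le> \<rho> / \<tau> ^ 3" if i: "i \<in> {1..n}" for i
  proof -
    have "prob (L i) = measure (distr M borel (Xs i)) {u. \<bar>u\<bar> \<ge> \<tau>}"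
      using rv[OF i] by (subst measure_distr) (auto simp: L_def intro!: arg_cong[where f = prob])
    also have "\<dots> = prob {\<omega> \<in> space M. \<bar>X \<omega>\<bar> \<ge> \<tau>}"
      unfolding iid[OF i] by (subst measure_distr) (auto intro!: arg_cong[where f = prob])
    also have "{\<omega> \<in> space M. \<bar>X \<omega>\<bar> \<ge> \<tau>} = {\<omega> \<in> space M. \<bar>X \<omega>\<bar> ^ 3 \<ge> \<tau> ^ 3}"
      using \<tau> by (simp add: power_mono_iff)
    also have "prob \<dots> \<le> (\<integral>\<omega>\<in>space M. \<bar>X \<omega>\<bar> ^ 3 \<partial>M) / \<tau> ^ 3"
    proof (rule integral_Markov_inequality'_measure)
      show "set_integrable M (space M) (\<lambda>\<omega>. \<bar>X \<omega>\<bar> ^ 3)"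
        unfolding set_integrable_def using int3 by (rule integrable_mult_indicator[rotated]) simp
    qed (use \<tau> in auto)
    also have "(\<integral>\<omega>\<in>space M. \<bar>X \<omega>\<bar> ^ 3 \<partial>M) = \<rho>"
      unfolding \<rho>_def using int3 by (rule set_integral_space)
    finally show ?thesis .
  qed
  have "{\<omega> \<in> space M. \<bar>\<Sum>i=1..n. Xs i \<omega>\<bar> \<ge> x} \<subseteq> (T 1 \<union> T (- 1)) \<union> (\<Union>i\<in>{1..n}. L i)"
  proof
    fix \<omega> assume \<omega>: "\<omega> \<in> {\<omega> \<in> space M. \<bar>\<Sum>i=1..n. Xs i \<omega>\<bar> \<ge> x}"
    show "\<omega> \<in> (T 1 \<union> T (- 1)) \<union> (\<Union>i\<in>{1..n}. L i)"
    proof (cases "\<exists>i\<in>{1..n}. \<bar>Xs i \<omega>\<bar> \<ge> \<tau>")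
      case True
      then show ?thesis using \<omega> by (auto simp: L_def)
    next
      case False
      then have eq: "(\<Sum>i=1..n. \<sigma> * cutoff \<tau> (Xs i \<omega>)) = \<sigma> * (\<Sum>i=1..n. Xs i \<omega>)" for \<sigma>
        unfolding sum_distrib_left cutoff_def by (intro sum.cong refl) (simp add: not_le less_imp_le)
      have "\<omega> \<in> T \<sigma> \<longleftrightarrow> x \<le> \<sigma> * (\<Sum>i=1..n. Xs i \<omega>)" for \<sigma>
        using \<omega> unfolding T_def mem_Collect_eq eq by blast
      then show ?thesis using \<omega> by (auto simp: abs_real_def split: if_splits)
    qed
  qed
  then have "prob {\<omega> \<in> space M. \<bar>\<Sum>i=1..n. Xs i \<omega>\<bar> \<ge> x} \<le> prob ((T 1 \<union> T (- 1)) \<union> (\<Union>i\<in>{1..n}. L i))"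
    using T_sets L_sets by (intro finite_measure_mono) auto
  also have "\<dots> \<le> prob (T 1 \<union> T (- 1)) + prob (\<Union>i\<in>{1..n}. L i)"
    using T_sets L_sets by (intro measure_Un_le) auto
  also have "prob (T 1 \<union> T (- 1)) \<le> prob (T 1) + prob (T (- 1))"
    using T_sets by (intro measure_Un_le) auto
  also have "prob (T 1) \<le> exp (- (x\<^sup>2 / (4 * real n)))"
    unfolding T_def \<tau>_def by (rule cutoffd_sum_tail[OF sym int var indep iid n x]) auto
  also have "prob (T (- 1)) \<le> exp (- (x\<^sup>2 / (4 * real n)))"
    unfolding T_def \<tau>_def by (rule cutoffd_sum_tail[OF sym int var indep iid n x]) auto
  also have "prob (\<Union>i\<in>{1..n}. L i) \<le> (\<Sum>i\<in>{1..n}. prob (L i))"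
    using L_sets by (intro finite_measure_subadditive_finite) auto
  also have "\<dots> \<le> (\<Sum>i\<in>{1..n}. \<rho> / \<tau> ^ 3)" by (intro sum_mono L_le)
  also have "\<dots> = \<rho> * x ^ 3 / (8 * (real n)\<^sup>2)"
    using n x by (simp add: \<tau>_def field_simps power2_eq_square power3_eq_cube)
  finally show ?thesis by (simp add: \<rho>_def)
qed

section \<open>Prime values of random sums\<close>

theorem theorem7p7:
  fixes M :: "'a measure" and X :: "'a \<Rightarrow> real" and Xs :: "nat \<Rightarrow> 'a \<Rightarrow> real" and B :: real
  assumes "prob_space M"
    and "symmetric_rv M X"
    and "(\<integral>\<omega>. X \<omega> \<partial>M) = 0"
    and "(\<integral>\<omega>. X \<omega> ^ 3 \<partial>M) = 0"
    and "(\<integral>\<omega>. (X \<omega>)\<^sup>2 \<partial>M) = 1"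
    and "\<exists>\<epsilon>>0. integrable M (\<lambda>\<omega>. \<bar>X \<omega>\<bar> powr (3 + \<epsilon>))"
    and "independent_copies M X Xs"
    and "B > 1"
  shows "\<exists>C::real. \<forall>(k :: nat \<Rightarrow> nat) (l :: nat \<Rightarrow> int).
           (\<forall>n. k n > 0) \<and> (\<forall>n. odd (l n)) \<and> (\<forall>n. coprime (l n) (int (k n))) \<and>
           filterlim (\<lambda>n. sqrt (real n * ln (ln (real n))) / real (k n)) at_top sequentially
           \<longrightarrow>
           (\<forall>\<^sub>F n in sequentially.
              measure M {\<omega> \<in> space M. prime_in_class (\<Sum>i=1..n. Xs i \<omega>) (l n) (k n)}
              \<le> C * (sqrt (ln (ln (real n))) / (real (totient (k n)) * ln (real n))
                     + 1 / ln (real n) powr B))"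
proof -
  interpret prob_space M by fact
  have rv [measurable]: "random_variable borel X" using assms(2) by (simp add: symmetric_rv_def)
  \<comment> \<open>A function that is not integrable has integral 0 by default, so the value 1
    forces integrability.\<close>
  have int2: "integrable M (\<lambda>\<omega>. (X \<omega>)\<^sup>2)"
    using assms(5) not_integrable_integral_eq by fastforce
  have int3: "integrable M (\<lambda>\<omega>. \<bar>X \<omega>\<bar> ^ 3)"
  proof -
    obtain \<epsilon> where \<epsilon>: "\<epsilon> > 0" "integrable M (\<lambda>\<omega>. \<bar>X \<omega>\<bar> powr (3 + \<epsilon>))" using assms(6) by blast
    have "\<bar>u\<bar> ^ 3 \<le> 1 + \<bar>u\<bar> powr (3 + \<epsilon>)" for u :: real
    proof (cases "\<bar>u\<bar> \<le> 1")
      case True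
      then have "\<bar>u\<bar> ^ 3 \<le> 1" by (simp add: power_le_one)
      then show ?thesis using powr_ge_zero[of "\<bar>u\<bar>" "3 + \<epsilon>"] by linarith
    next
      case False
      then have "\<bar>u\<bar> ^ 3 = \<bar>u\<bar> powr 3" by (simp add: powr_numeral)
      also have "\<dots> \<le> \<bar>u\<bar> powr (3 + \<epsilon>)" using False \<epsilon>(1) by (intro powr_mono) auto
      finally show ?thesis by simp
    qed
    then show ?thesis
      by (intro Bochner_Integration.integrable_bound[OF Bochner_Integration.integrable_add
        [OF integrable_const[of 1] \<epsilon>(2)]]) auto
  qed
  have int1: "integrable M X"
    by (rule square_integrable_imp_integrable[OF rv int2])
  have indep: "indep_vars (\<lambda>_. borel) Xs {1..}"
    and iid: "\<And>i. i \<ge> 1 \<Longrightarrow> distr M borel (Xs i) = distr M borel X"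
    using assms(7) by (auto simp: independent_copies_def)
  obtain C0 where C0: "C0 > 0" and local_bound: "\<forall>\<^sub>F n in sequentially. \<forall>y.
      prob {\<omega> \<in> space M. (\<Sum>i=1..n. Xs i \<omega>) = y} \<le> C0 / sqrt (real n)"
    using point_prob_iid_sum_le[OF rv int1 int2 int3 assms(3,5) indep iid] by blast
  define \<rho> where "\<rho> = expectation (\<lambda>\<omega>. \<bar>X \<omega>\<bar> ^ 3)"
  \<comment> \<open>Chosen so that x^2/(4n) = B log log n, which makes the exponential in the tail
    bound exactly (log n)^(-B).\<close>
  define x where "x = (\<lambda>n::nat. 2 * sqrt B * sqrt (real n * ln (ln (real n))))"
  \<comment> \<open>Then \<open>z ^ 4\<close> is at most n^(1/4), well below sqrt n. The exponent
    1/32 used later absorbs the floor and gives ln z \<ge> (ln n)/32.\<close>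
  define z where "z = (\<lambda>n::nat. nat \<lfloor>real n powr (1 / 16)\<rfloor>)"
  \<comment> \<open>192 = 2 * 3 * 32: the 2 from \<open>x\<close>, the 3 from
    \<open>2 * N + 1 \<le> 3 * x\<close>, the 32 from the bound for ln z. The 4 collects two
    exponential tails, the large-summand term and the sieve remainder.\<close>
  define C where "C = 192 * C0 * sqrt B + 4"
  have B: "B > 0" using assms(8) by simp
  have ev: "\<forall>\<^sub>F n in sequentially. n > 0 \<and> ln (real n) > 0 \<and> ln (ln (real n)) > 0 \<and> x n \<ge> 1
      \<and> real n powr (1 / 16) - 1 \<ge> real n powr (1 / 32) \<and> real n powr (1 / 32) \<ge> 2
      \<and> 4 * real n powr (1 / 4) * (C0 / sqrt (real n)) \<le> 1 / ln (real n) powr B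
      \<and> \<rho> * x n ^ 3 / (8 * (real n)\<^sup>2) \<le> 1 / ln (real n) powr B"
    unfolding x_def
  proof (intro eventually_conj)
    show "\<forall>\<^sub>F n in sequentially. (n::nat) > 0" by real_asymp
    show "\<forall>\<^sub>F n in sequentially. ln (real n) > 0" by real_asymp
    show "\<forall>\<^sub>F n in sequentially. ln (ln (real n)) > 0" by real_asymp
    show "\<forall>\<^sub>F n in sequentially. 2 * sqrt B * sqrt (real n * ln (ln (real n))) \<ge> 1"
      using B by real_asymp
    show "\<forall>\<^sub>F n in sequentially. real n powr (1 / 16) - 1 \<ge> real n powr (1 / 32)" by real_asymp
    show "\<forall>\<^sub>F n in sequentially. real n powr (1 / 32) \<ge> 2" by real_asymp
    show "\<forall>\<^sub>F n in sequentially. 4 * real n powr (1 / 4) * (C0 / sqrt (real n)) \<le> 1 / ln (real n) powr B"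
      using C0 B by real_asymp
    \<comment> \<open>The moment \<rho> is split off as a constant whose sign is left open. The
      other factor has order (log log n)^(3/2) (log n)^B / sqrt n and tends to 0.\<close>
    have "(\<lambda>n. \<rho> * ((2 * sqrt B * sqrt (real n * ln (ln (real n)))) ^ 3 / (8 * (real n)\<^sup>2) * ln (real n) powr B))
        \<longlonglongrightarrow> \<rho> * 0"
      using B by (intro tendsto_mult tendsto_const) real_asymp
    then have "\<forall>\<^sub>F n in sequentially.
        \<rho> * ((2 * sqrt B * sqrt (real n * ln (ln (real n)))) ^ 3 / (8 * (real n)\<^sup>2) * ln (real n) powr B) < 1"
      by (intro order_tendstoD(2)) auto
    moreover have "\<forall>\<^sub>F n in sequentially. ln (real n) > 0" by real_asymp
    ultimately show "\<forall>\<^sub>F n in sequentially.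
        \<rho> * (2 * sqrt B * sqrt (real n * ln (ln (real n)))) ^ 3 / (8 * (real n)\<^sup>2) \<le> 1 / ln (real n) powr B"
      by eventually_elim (simp add: pos_le_divide_eq)
  qed
  show ?thesis
  proof (intro exI[of _ C] allI impI, elim conjE)
    fix k :: "nat \<Rightarrow> nat" and l :: "nat \<Rightarrow> int"
    assume k: "\<forall>n. k n > 0" and cop: "\<forall>n. coprime (l n) (int (k n))"
    show "\<forall>\<^sub>F n in sequentially.
              measure M {\<omega> \<in> space M. prime_in_class (\<Sum>i=1..n. Xs i \<omega>) (l n) (k n)}
              \<le> C * (sqrt (ln (ln (real n))) / (real (totient (k n)) * ln (real n))
                     + 1 / ln (real n) powr B)"
      using ev local_bound
    proof eventually_elim
      case (elim n)
      then have n: "n > 0" "ln (ln (real n)) > 0" "x n \<ge> 1"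
        "real n powr (1 / 16) - 1 \<ge> real n powr (1 / 32)" "real n powr (1 / 32) \<ge> 2"
        "4 * real n powr (1 / 4) * (C0 / sqrt (real n)) \<le> 1 / ln (real n) powr B"
        "\<rho> * x n ^ 3 / (8 * (real n)\<^sup>2) \<le> 1 / ln (real n) powr B"
        and lnn: "ln (real n) > 0"
        and loc: "\<And>y. prob {\<omega> \<in> space M. (\<Sum>i=1..n. Xs i \<omega>) = y} \<le> C0 / sqrt (real n)"
        by auto
      have tot: "real (totient (k n)) > 0" using k by simp
      define S where "S = (\<lambda>\<omega>. \<Sum>i=1..n. Xs i \<omega>)"
      define N where "N = \<lfloor>x n\<rfloor>"
      define R where "R = {r\<in>{-N..N}. prime \<bar>r\<bar> \<and> [r = l n] (mod int (k n))}"
      have indep_n: "indep_vars (\<lambda>_. borel) Xs {1..n}"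
        using indep by (rule indep_vars_subset) auto
      then have [measurable]: "random_variable borel S"
        unfolding S_def by (intro borel_measurable_sum) (auto simp: indep_vars_def)
      have finR: "finite R" unfolding R_def by (rule finite_subset[of _ "{-N..N}"]) auto
      \<comment> \<open>Although \<open>S\<close> is real-valued, a prime value is an integer. Below
        \<open>x n\<close> only the finitely many points of \<open>R\<close> remain, and the point
        masses can be added up.\<close>
      have "{\<omega> \<in> space M. prime_in_class (S \<omega>) (l n) (k n)}
          \<subseteq> {\<omega> \<in> space M. \<bar>S \<omega>\<bar> \<ge> x n} \<union> (\<Union>r\<in>R. {\<omega> \<in> space M. S \<omega> = of_int r})"
      proof
        fix \<omega> assume "\<omega> \<in> {\<omega> \<in> space M. prime_in_class (S \<omega>) (l n) (k n)}"
        then obtain r where r: "\<omega> \<in> space M" "S \<omega> = of_int r" "prime \<bar>r\<bar>" "[r = l n] (mod int (k n))"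
          by (auto simp: prime_in_class_def)
        show "\<omega> \<in> {\<omega> \<in> space M. \<bar>S \<omega>\<bar> \<ge> x n} \<union> (\<Union>r\<in>R. {\<omega> \<in> space M. S \<omega> = of_int r})"
        proof (cases "\<bar>S \<omega>\<bar> \<ge> x n")
          case False
          then have "of_int \<bar>r\<bar> \<le> x n" using r by simp
          then have "\<bar>r\<bar> \<le> N" unfolding N_def by (simp only: le_floor_iff)
          then have "r \<in> R" using r by (auto simp: R_def)
          then show ?thesis using r by auto
        qed (use r in auto)
      qed
      then have "prob {\<omega> \<in> space M. prime_in_class (S \<omega>) (l n) (k n)}
          \<le> prob ({\<omega> \<in> space M. \<bar>S \<omega>\<bar> \<ge> x n} \<union> (\<Union>r\<in>R. {\<omega> \<in> space M. S \<omega> = of_int r}))"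
        using finR by (intro finite_measure_mono) auto
      also have "\<dots> \<le> prob {\<omega> \<in> space M. \<bar>S \<omega>\<bar> \<ge> x n} + prob (\<Union>r\<in>R. {\<omega> \<in> space M. S \<omega> = of_int r})"
        using finR by (intro measure_Un_le) auto
      also have "prob (\<Union>r\<in>R. {\<omega> \<in> space M. S \<omega> = of_int r}) \<le> (\<Sum>r\<in>R. prob {\<omega> \<in> space M. S \<omega> = of_int r})"
        using finR by (intro finite_measure_subadditive_finite) auto
      also have "\<dots> \<le> (\<Sum>r\<in>R. C0 / sqrt (real n))"
        unfolding S_def by (intro sum_mono loc)
      also have "\<dots> = real (card R) * (C0 / sqrt (real n))" by simp
      also have "\<dots> \<le> (96 * x n / (real (totient (k n)) * ln (real n)) + 4 * real n powr (1 / 4)) * (C0 / sqrt (real n))"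
      proof (rule mult_right_mono)
        have z_le: "real (z n) \<le> real n powr (1 / 16)" and z_ge: "real (z n) \<ge> real n powr (1 / 32)"
          unfolding z_def using n(4,5) by linarith+
        have z2: "z n \<ge> 2" using z_ge n(5) by linarith
        have lnz: "ln (real (z n)) \<ge> ln (real n) / 32"
        proof -
          have "ln (real n) / 32 = ln (real n powr (1 / 32))" using n(1) by (simp add: ln_powr)
          also have "\<dots> \<le> ln (real (z n))" using z_ge z2 n(1) by (subst ln_le_cancel_iff) auto
          finally show ?thesis .
        qed
        have "real (card R) \<le> (2 * real_of_int N + 1) / (real (totient (k n)) * ln (real (z n)))
            + real (z n) ^ 4 + 2 * real (z n) + 1"
          unfolding R_def using k cop z2 n(3) by (intro brun_titchmarsh) (auto simp: N_def)
        also have "(2 * real_of_int N + 1) / (real (totient (k n)) * ln (real (z n)))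
            \<le> 3 * x n / (real (totient (k n)) * (ln (real n) / 32))"
        proof (rule frac_le)
          show "2 * real_of_int N + 1 \<le> 3 * x n" unfolding N_def using n(3) by linarith
          show "real (totient (k n)) * (ln (real n) / 32) \<le> real (totient (k n)) * ln (real (z n))"
            using tot lnz by (intro mult_left_mono) auto
        qed (use n lnn tot in auto)
        also have "3 * x n / (real (totient (k n)) * (ln (real n) / 32))
            = 96 * x n / (real (totient (k n)) * ln (real n))" by simp
        finally have "real (card R) \<le> 96 * x n / (real (totient (k n)) * ln (real n))
            + (real (z n) ^ 4 + 2 * real (z n) + 1)" by simp
        moreover have "real (z n) ^ 4 + 2 * real (z n) + 1 \<le> 4 * real n powr (1 / 4)"
        proof -
          have "real (z n) \<le> real (z n) ^ 4" "1 \<le> real (z n) ^ 4"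
            using z2 by (auto intro: self_le_power one_le_power)
          then have "real (z n) ^ 4 + 2 * real (z n) + 1 \<le> 4 * real (z n) ^ 4" by linarith
          also have "\<dots> \<le> 4 * (real n powr (1 / 16)) ^ 4"
            using z_le by (intro mult_left_mono power_mono) auto
          also have "(real n powr (1 / 16)) ^ 4 = real n powr (1 / 4)"
            using n(1) by (simp add: powr_power)
          finally show ?thesis .
        qed
        ultimately show "real (card R) \<le> 96 * x n / (real (totient (k n)) * ln (real n)) + 4 * real n powr (1 / 4)"
          by linarith
      qed (use C0 in simp)
      also have "\<dots> = 96 * x n / (real (totient (k n)) * ln (real n)) * (C0 / sqrt (real n))
          + 4 * real n powr (1 / 4) * (C0 / sqrt (real n))" by (rule distrib_right)
      also have "4 * real n powr (1 / 4) * (C0 / sqrt (real n)) \<le> 1 / ln (real n) powr B" by (rule n(6))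
      \<comment> \<open>Here sqrt n cancels, and \<open>x n / sqrt n\<close> leaves the factor 2
        sqrt (B log log n).\<close>
      also have "96 * x n / (real (totient (k n)) * ln (real n)) * (C0 / sqrt (real n))
          = 192 * C0 * sqrt B * (sqrt (ln (ln (real n))) / (real (totient (k n)) * ln (real n)))"
        using n(1) by (simp add: x_def real_sqrt_mult)
      also have "prob {\<omega> \<in> space M. \<bar>S \<omega>\<bar> \<ge> x n}
          \<le> 2 * exp (- ((x n)\<^sup>2 / (4 * real n))) + \<rho> * x n ^ 3 / (8 * (real n)\<^sup>2)"
        unfolding S_def \<rho>_def
        by (rule symmetric_sum_tail[OF assms(2) int2 _ int3 indep_n]) (use assms(5) iid n in auto)
      also have "\<rho> * x n ^ 3 / (8 * (real n)\<^sup>2) \<le> 1 / ln (real n) powr B" by (rule n(7))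
      also have "exp (- ((x n)\<^sup>2 / (4 * real n))) = 1 / ln (real n) powr B"
      proof -
        have "(x n)\<^sup>2 / (4 * real n) = B * ln (ln (real n))"
          using n(1,2) B by (simp add: x_def power_mult_distrib)
        then show ?thesis using lnn by (simp add: powr_def exp_minus inverse_eq_divide)
      qed
      finally have "prob {\<omega> \<in> space M. prime_in_class (S \<omega>) (l n) (k n)}
          \<le> 192 * C0 * sqrt B * (sqrt (ln (ln (real n))) / (real (totient (k n)) * ln (real n)))
            + 4 * (1 / ln (real n) powr B)" by simp
      also have "\<dots> \<le> C * (sqrt (ln (ln (real n))) / (real (totient (k n)) * ln (real n)))
            + C * (1 / ln (real n) powr B)"
        using C0 B n(2) lnn tot by (intro add_mono mult_right_mono) (auto simp: C_def)
      finally show ?case by (simp add: S_def distrib_left)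
    qed
  qed
qed

thm_deps theorem7p7

end
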